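(* Let $\{(\boldsymbol X(t),V(t)),t\ge 0\}$ be the cyclic random motion in $\mathbb R^3$ described in the context, started from the origin with initial direction $\vec v_1$. Then for all $t>0$, $\boldsymbol x\in\mathrm{Int}(\mathcal T(t))$ and $1\le j\le 4$, the absolutely continuous component $p_{1j}(\boldsymbol x,t)\,d\boldsymbol x=\mathbb P_1\{\boldsymbol X(t)\in d\boldsymbol x,\,V(t)=\vec v_j\}$ of the probability law is given by $$p_{1j}(\boldsymbol x,t)=\frac1{|\det\boldsymbol A|}\sum_{k=0}^{\infty}\Bigg\{\prod_{i=1}^{j-1}f_{D_i^{(k+1)}}(\tau_i)\prod_{i=j+1}^{4}f_{D_i^{(k)}}(\tau_i)\int_{t-\tau_j}^{t}f_{D_j^{(k)}}\big(s-(t-\tau_j)\big)\,\overline F_{D_{j,k+1}\mid D_j^{(k)}}\big(t-s\mid s-(t-\tau_j)\big)\,ds\Bigg\},$$ where $\tau_i=\tau_i(\boldsymbol x,t)$, $1\le i\le4$, are the components of the solution $\boldsymbol\tau=(\tau_1,\tau_2,\tau_3,\tau_4)^T$ of $\boldsymbol A\boldsymbol\tau=(x_1,x_2,x_3,t)^T$.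
   Context: Directions. For $1\le j\le 4$ let $\vec v_j=(\cos\theta_j\sin\varphi_j,\ \sin\theta_j\sin\varphi_j,\ \cos\varphi_j)$, $\theta_j\in[0,2\pi]$, $\varphi_j\in[0,\pi]$, be unit vectors of $\mathbb R^3$ that are affinely independent, and let $c>0$. $\mathcal T(t)$ is the tetrahedron with vertices $ct\,\vec v_j$, $1\le j\le4$ (their convex hull). $\boldsymbol A$ is the (invertible) $4\times4$ matrix whose $j$-th column is $(c\cos\theta_j\sin\varphi_j,\ c\sin\theta_j\sin\varphi_j,\ c\cos\varphi_j,\ 1)^T$. Durations. For each $j\in\{1,2,3,4\}$, $(D_{j,k})_{k\ge1}$ is the sequence of interarrival times of a geometric counting process (GCP) with intensity $\lambda_j>0$: a mixed Poisson process whose random intensity $\alpha_j$ is exponentially distributed with mean $\lambda_j$ (given $\alpha_j$, the $D_{j,k}$, $k\ge 1$, are i.i.d. exponential with rate $\alpha_j$). The four sequences are mutually independent. Put $D_j^{(0)}=0$, $D_j^{(k)}=\sum_{i=1}^kD_{j,i}$. Motion. The particle starts at the origin at time $0$ with direction $\vec v_1$ and takes directions cyclically $\vec v_1\to\vec v_2\to\vec v_3\to\vec v_4\to\vec v_1\to\cdots$; during the $k$-th cycle it moves along $\vec v_j$ for a time $D_{j,k}$. Thus the switching times are $T_0=0$ and $T_{4n+j}=\sum_{r=1}^{j}D_r^{(n+1)}+\sum_{r=j+1}^{4}D_r^{(n)}$ for $n\ge0$, $1\le j\le4$; $V(t)=\vec v_j$ for $T_{4n+j-1}\le t<T_{4n+j}$;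 and $\boldsymbol X(t)=c\int_0^tV(s)\,ds$. $\mathbb P_1$ denotes probability conditional on $\{\boldsymbol X(0)=\boldsymbol 0, V(0)=\vec v_1\}$. Notation. $p_{1j}(\cdot,t)$ is the density (w.r.t. Lebesgue measure) of the law on the interior of $\mathcal T(t)$: $\mathbb P_1\{\boldsymbol X(t)\in B,V(t)=\vec v_j\}=\int_Bp_{1j}(\boldsymbol x,t)\,d\boldsymbol x$ for Borel $B\subseteq\mathrm{Int}(\mathcal T(t))$; equality is as densities. $f_{D_j^{(k)}}$ is the probability density of $D_j^{(k)}$, $k\ge1$, and $\overline F_{D_{j,k+1}\mid D_j^{(k)}}(s\mid u)=\mathbb P\{D_{j,k+1}>s\mid D_j^{(k)}=u\}$. Empty products are $1$. Since $D_j^{(0)}=0$, for $k=0$ the symbol $f_{D_j^{(0)}}$ is understood as the Dirac delta at $0$: a factor $f_{D_i^{(0)}}(\tau_i)$ with $\tau_i>0$ is $0$, and the integral with $k=0$ equals $\mathbb P\{D_{j,1}>\tau_j\}$. *)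

theory Defs
  imports "HOL-Probability.Probability"
begin

definition direction :: "real \<Rightarrow> real \<Rightarrow> real^3" where
  "direction \<theta> \<phi> = vector [cos \<theta> * sin \<phi>, sin \<theta> * sin \<phi>, cos \<phi>]"

definition tetrahedron :: "real \<Rightarrow> (nat \<Rightarrow> real^3) \<Rightarrow> real \<Rightarrow> (real^3) set" where
  "tetrahedron c v t = convex hull ((\<lambda>j. (c * t) *\<^sub>R v j) ` {1..4})"

definition motion_column :: "real \<Rightarrow> real^3 \<Rightarrow> real^4" where
  "motion_column c u = vector [c * u $ 1, c * u $ 2, c * u $ 3, 1]"

definition motion_matrix :: "real \<Rightarrow> (nat \<Rightarrow> real^3) \<Rightarrow> real^4^4" where
  "motion_matrix c v = transpose (vector
     [motion_column c (v 1), motion_column c (v 2), motion_column c (v 3), motion_column c (v 4)])"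

text \<open>
  The cast \<^term>\<open>of_nat\<close> maps the indices 1, 2, 3, 4 to the corresponding elements of the
  index type of \<^typ>\<open>real^4\<close> (in which 4 and 0 coincide).
\<close>

definition tau :: "real \<Rightarrow> (nat \<Rightarrow> real^3) \<Rightarrow> real^3 \<Rightarrow> real \<Rightarrow> nat \<Rightarrow> real" where
  "tau c v x t i =
     (THE \<tau>::real^4. motion_matrix c v *v \<tau> = vector [x $ 1, x $ 2, x $ 3, t]) $ of_nat i"

text \<open>
  Interarrival times \<open>W k\<close>, \<open>k \<ge> 1\<close>, of a geometric counting process with intensity \<open>l\<close>:
  given the random intensity \<open>\<alpha>\<close>, which is exponential with mean \<open>l\<close> (that is, with rate
  \<open>1 / l\<close>), they are i.i.d. exponential with rate \<open>\<alpha>\<close>. Note that \<open>\<alpha> > 0\<close> almost surely.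
\<close>

definition gcp_interarrivals :: "'a measure \<Rightarrow> real \<Rightarrow> (nat \<Rightarrow> 'a \<Rightarrow> real) \<Rightarrow> bool" where
  "gcp_interarrivals M l W \<longleftrightarrow>
     (\<forall>k\<ge>1. W k \<in> borel_measurable M) \<and>
     (\<exists>\<alpha>. distributed M lborel \<alpha> (\<lambda>a. ennreal (exponential_density (1 / l) a)) \<and>
       (\<forall>n A. (\<forall>k\<in>{1..n}. A k \<in> sets borel) \<longrightarrow>
         (AE \<omega> in M.
           real_cond_exp M (vimage_algebra (space M) \<alpha> borel)
             (indicator {\<omega>\<in>space M. \<forall>k\<in>{1..n}. W k \<omega> \<in> A k}) \<omega> =
           (\<Prod>k=1..n. measure (density lborel (\<lambda>x. ennreal (exponential_density (\<alpha> \<omega>) x))) (A k)))))"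

definition partial_duration :: "(nat \<Rightarrow> nat \<Rightarrow> 'a \<Rightarrow> real) \<Rightarrow> nat \<Rightarrow> nat \<Rightarrow> 'a \<Rightarrow> real" where
  "partial_duration D j k \<omega> = (\<Sum>i=1..k. D j i \<omega>)"

text \<open>For \<open>m \<ge> 1\<close> we write \<open>m = 4 * n + j\<close> with \<open>1 \<le> j \<le> 4\<close>.\<close>

definition switching_time :: "(nat \<Rightarrow> nat \<Rightarrow> 'a \<Rightarrow> real) \<Rightarrow> nat \<Rightarrow> 'a \<Rightarrow> real" where
  "switching_time D m \<omega> =
     (if m = 0 then 0
      else let n = (m - 1) div 4; j = (m - 1) mod 4 + 1 in
        (\<Sum>r=1..j. partial_duration D r (n + 1) \<omega>) + (\<Sum>r=j+1..4. partial_duration D r n \<omega>))"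

text \<open>
  The index below exists and is unique at all times, outside the null event on which the durations
  are not all positive or the switching times are bounded.
\<close>

definition velocity ::
  "(nat \<Rightarrow> real^3) \<Rightarrow> (nat \<Rightarrow> nat \<Rightarrow> 'a \<Rightarrow> real) \<Rightarrow> real \<Rightarrow> 'a \<Rightarrow> real^3" where
  "velocity v D t \<omega> = v (THE j. j \<in> {1..4} \<and>
     (\<exists>n. switching_time D (4 * n + j - 1) \<omega> \<le> t \<and> t < switching_time D (4 * n + j) \<omega>))"

definition position ::
  "real \<Rightarrow> (nat \<Rightarrow> real^3) \<Rightarrow> (nat \<Rightarrow> nat \<Rightarrow> 'a \<Rightarrow> real) \<Rightarrow> real \<Rightarrow> 'a \<Rightarrow> real^3" where
  "position c v D t \<omega> = c *\<^sub>R (LBINT s:{0..t}. velocity v D s \<omega>)"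

text \<open>
  \<open>p\<close> is a version of the density, on the interior of the tetrahedron, of the law of the position
  at time \<open>t\<close> on the event that the direction is then \<open>v j\<close>, given that the motion starts at the
  origin in direction \<open>v 1\<close>.
\<close>

definition is_motion_density ::
  "'a measure \<Rightarrow> real \<Rightarrow> (nat \<Rightarrow> real^3) \<Rightarrow> (nat \<Rightarrow> nat \<Rightarrow> 'a \<Rightarrow> real) \<Rightarrow> nat \<Rightarrow> real \<Rightarrow>
    (real^3 \<Rightarrow> ennreal) \<Rightarrow> bool" where
  "is_motion_density M c v D j t p \<longleftrightarrow>
     p \<in> borel_measurable (restrict_space borel (interior (tetrahedron c v t))) \<and>
     (\<forall>B\<in>sets borel. B \<subseteq> interior (tetrahedron c v t) \<longrightarrow>
        ennreal (cond_prob M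
          (\<lambda>\<omega>. position c v D t \<omega> \<in> B \<and> velocity v D t \<omega> = v j)
          (\<lambda>\<omega>. position c v D 0 \<omega> = 0 \<and> velocity v D 0 \<omega> = v 1)) =
        (\<integral>\<^sup>+x\<in>B. p x \<partial>lborel))"

text \<open>
  \<open>G s u\<close> is a version of the conditional probability of \<open>Y > s\<close> given \<open>X = u\<close>, obtained from a
  regular conditional distribution of \<open>Y\<close> given \<open>X\<close>. (Choosing a version for each \<open>s\<close>
  separately would not even guarantee joint measurability of \<open>G\<close>.)
\<close>

definition is_cond_survival ::
  "'a measure \<Rightarrow> ('a \<Rightarrow> real) \<Rightarrow> ('a \<Rightarrow> real) \<Rightarrow> (real \<Rightarrow> real \<Rightarrow> real) \<Rightarrow> bool" where
  "is_cond_survival M Y X G \<longleftrightarrow>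
     (\<exists>K \<in> borel \<rightarrow>\<^sub>M prob_algebra borel.
       (\<forall>A\<in>sets borel. \<forall>B\<in>sets borel.
          emeasure M {\<omega>\<in>space M. X \<omega> \<in> A \<and> Y \<omega> \<in> B} =
          (\<integral>\<^sup>+u\<in>A. emeasure (K u) B \<partial>distr M borel X)) \<and>
       (\<forall>s u. G s u = measure (K u) {s<..}))"

text \<open>
  The law of the empty sum of durations is the Dirac measure at 0. Its density, understood as a
  Dirac delta, only occurs as a factor at points \<open>y > 0\<close> (all components of \<^const>\<open>tau\<close> are positive in the
  interior of the tetrahedron), where it vanishes.
\<close>

definition duration_density :: "(nat \<Rightarrow> nat \<Rightarrow> real \<Rightarrow> ennreal) \<Rightarrow> nat \<Rightarrow> nat \<Rightarrow> real \<Rightarrow> ennreal" where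
  "duration_density f i k y = (if k = 0 then 0 else f i k y)"

text \<open>
  For \<open>k = 0\<close>, integrating against the Dirac delta leaves the unconditional survival probability of
  the first duration.
\<close>

definition survival_integral ::
  "'a measure \<Rightarrow> (nat \<Rightarrow> nat \<Rightarrow> 'a \<Rightarrow> real) \<Rightarrow> (nat \<Rightarrow> nat \<Rightarrow> real \<Rightarrow> ennreal) \<Rightarrow>
    (nat \<Rightarrow> nat \<Rightarrow> real \<Rightarrow> real \<Rightarrow> real) \<Rightarrow> nat \<Rightarrow> nat \<Rightarrow> real \<Rightarrow> real \<Rightarrow> ennreal" where
  "survival_integral M D f G j k t y =
     (if k = 0 then emeasure M {\<omega>\<in>space M. D j 1 \<omega> > y}
      else (\<integral>\<^sup>+s\<in>{t - y..t}. f j k (s - (t - y)) * ennreal (G j k (t - s) (s - (t - y))) \<partial>lborel))"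

end

theory Submission
  imports Defs
begin

text \<open>
  Between time \<open>0\<close> and time \<open>t\<close> the particle spends a total time \<open>\<tau>\<^sub>i\<close> along each direction
  \<open>v i\<close>. These four occupation times sum to \<open>t\<close>, and the position is \<open>c (\<tau>\<^sub>1 v\<^sub>1 + \<dots> + \<tau>\<^sub>4 v\<^sub>4)\<close>.
  Because the directions are affinely independent, position and time determine the occupation
  times: they are the solution \<^const>\<open>tau\<close> of the linear system.

  Suppose that at time \<open>t\<close> the particle moves along \<open>v j\<close> after \<open>k\<close> completed cycles. Each
  direction \<open>i < j\<close> has then been used \<open>k + 1\<close> times to the end and each \<open>i > j\<close> has been
  used \<open>k\<close> times to the end, so for \<open>i \<noteq> j\<close> the occupation time \<open>\<tau>\<^sub>i\<close> is exactly a partial sum of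
  durations, with a density. The remaining time \<open>\<tau>\<^sub>j\<close> is what is left of \<open>t\<close>, and the
  only further condition is that the \<open>(k + 1)\<close>-st leg along \<open>v j\<close> is running, that is,
  \<open>D\<^sub>j\<^sup>(\<^sup>k\<^sup>) \<le> \<tau>\<^sub>j < D\<^sub>j\<^sup>(\<^sup>k\<^sup>+\<^sup>1\<^sup>)\<close>. Disintegrating with respect to \<open>D\<^sub>j\<^sup>(\<^sup>k\<^sup>)\<close> shows that this has probability
  equal to the survival integral at \<open>\<tau>\<^sub>j\<close> (lemma \<open>survival_integral_eq\<close>).

  By independence, the law of the three partial sums together with this condition is an iterated
  integral of the product of the densities and the survival integral
  (lemma \<open>emeasure_phase_event_integral\<close>). The map from the three partial sums to the position is
  affine, and its determinant is, up to sign, that of the motion matrix, as one sees by subtracting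
  column \<open>j\<close> from the others. The change of variables therefore produces the factor
  \<open>1 / \<bar>det A\<bar>\<close> (lemma \<open>emeasure_phase_event\<close>). Summation over \<open>k\<close> gives the density.

  Two degenerate situations contribute nothing. A term in which some direction \<open>i \<noteq> j\<close>
  has not been used corresponds to \<open>\<tau>\<^sub>i = 0\<close>, hence to a position on the boundary, whereas all
  \<open>\<tau>\<^sub>i\<close> are positive in the interior (lemma \<open>tau_pos\<close>). Paths with a nonpositive duration or with
  bounded switching times have probability \<open>0\<close>; here the geometric counting processes enter:
  given an intensity \<open>a > 0\<close>, the durations are i.i.d. exponential, so \<open>n\<close> of
  them are all at most \<open>s\<close> with probability \<open>(1 - exp (- a s))\<^sup>n\<close>, which tends to \<open>0\<close>.
\<close>

section \<open>Iterated integrals and affine changes of variables\<close>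

lemma measurable_vec3:
  "(\<lambda>(x, y, z). vector [x, y, z] :: real^3) \<in> lborel \<Otimes>\<^sub>M lborel \<Otimes>\<^sub>M lborel \<rightarrow>\<^sub>M borel"
proof -
  have "(\<lambda>(x, y, z). vector [x, y, z] :: real^3) =
      (\<lambda>(x, y, z). x *\<^sub>R axis 1 1 + y *\<^sub>R axis 2 1 + z *\<^sub>R axis 3 1)"
    by (auto simp: fun_eq_iff vec_eq_iff forall_3 axis_def)
  then show ?thesis by simp
qed

lemma lborel_vec3_eq_distr:
  "(lborel :: (real^3) measure) =
     distr (lborel \<Otimes>\<^sub>M lborel \<Otimes>\<^sub>M lborel) borel (\<lambda>(x, y, z). vector [x, y, z])"
proof (rule lborel_eqI)
  have B: "(Basis :: (real^3) set) = {axis 1 1, axis 2 1, axis 3 1}"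
    unfolding Basis_vec_def UNIV_3 by auto
  have [simp]: "axis 1 (1::real) \<noteq> (axis 2 1 :: real^3)" "axis 1 (1::real) \<noteq> (axis 3 1 :: real^3)"
    "axis 2 (1::real) \<noteq> (axis 3 1 :: real^3)"
    by (simp_all add: axis_eq_axis)
  note meas [measurable] = measurable_vec3
  have s: "sigma_finite_measure (lborel \<Otimes>\<^sub>M (lborel :: real measure) :: (real \<times> real) measure)"
    unfolding lborel_prod by (rule lborel.sigma_finite_measure_axioms)
  fix l u :: "real^3"
  assume "\<And>b. b \<in> Basis \<Longrightarrow> l \<bullet> b \<le> u \<bullet> b"
  from this[of "axis 1 1"] this[of "axis 2 1"] this[of "axis 3 1"]
  have le: "l $ 1 \<le> u $ 1" "l $ 2 \<le> u $ 2" "l $ 3 \<le> u $ 3"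
    by (simp_all add: B inner_axis)
  have "(\<lambda>(x, y, z). vector [x, y, z] :: real^3) -` box l u \<inter> space (lborel \<Otimes>\<^sub>M lborel \<Otimes>\<^sub>M lborel)
      = {l $ 1<..<u $ 1} \<times> {l $ 2<..<u $ 2} \<times> {l $ 3<..<u $ 3}"
    by (auto simp: mem_box B inner_axis space_pair_measure)
  then have "emeasure (distr (lborel \<Otimes>\<^sub>M lborel \<Otimes>\<^sub>M lborel) borel (\<lambda>(x, y, z). vector [x, y, z])) (box l u)
     = emeasure (lborel \<Otimes>\<^sub>M lborel \<Otimes>\<^sub>M lborel) ({l $ 1<..<u $ 1} \<times> {l $ 2<..<u $ 2} \<times> {l $ 3<..<u $ 3})"
    by (subst emeasure_distr) auto
  also have "\<dots> = ennreal (u $ 1 - l $ 1) * (ennreal (u $ 2 - l $ 2) * ennreal (u $ 3 - l $ 3))"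
    using le s by (simp add: lborel.emeasure_pair_measure_Times sigma_finite_measure.emeasure_pair_measure_Times)
  also have "\<dots> = (\<Prod>b\<in>Basis. (u - l) \<bullet> b)"
    using le by (simp add: B inner_axis ennreal_mult)
  finally show "emeasure (distr (lborel \<Otimes>\<^sub>M lborel \<Otimes>\<^sub>M lborel) borel (\<lambda>(x, y, z). vector [x, y, z])) (box l u)
     = (\<Prod>b\<in>Basis. (u - l) \<bullet> b)" .
qed simp

lemma nn_integral_lborel_vec3:
  assumes [measurable]: "h \<in> borel_measurable borel"
  shows "(\<integral>\<^sup>+x. \<integral>\<^sup>+y. \<integral>\<^sup>+z. h (vector [x, y, z] :: real^3) \<partial>lborel \<partial>lborel \<partial>lborel) = integral\<^sup>N lborel h"
proof -
  note meas [measurable] = measurable_vec3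
  have [measurable]: "(\<lambda>p. h (vector [fst p, fst (snd p), snd (snd p)])) \<in>
      borel_measurable (lborel \<Otimes>\<^sub>M lborel \<Otimes>\<^sub>M lborel)"
    using measurable_compose[OF meas assms] by (simp add: case_prod_beta)
  have s: "sigma_finite_measure (lborel \<Otimes>\<^sub>M (lborel :: real measure) :: (real \<times> real) measure)"
    unfolding lborel_prod by (rule lborel.sigma_finite_measure_axioms)
  have "integral\<^sup>N lborel h = (\<integral>\<^sup>+p. h (vector [fst p, fst (snd p), snd (snd p)]) \<partial>(lborel \<Otimes>\<^sub>M lborel \<Otimes>\<^sub>M lborel))"
    by (subst lborel_vec3_eq_distr, subst nn_integral_distr) (auto simp: case_prod_beta)
  also have "\<dots> = (\<integral>\<^sup>+x. \<integral>\<^sup>+p. h (vector [x, fst p, snd p]) \<partial>(lborel \<Otimes>\<^sub>M lborel) \<partial>lborel)"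
    by (subst sigma_finite_measure.nn_integral_fst[OF s, symmetric]) auto
  also have "\<dots> = (\<integral>\<^sup>+x. \<integral>\<^sup>+y. \<integral>\<^sup>+z. h (vector [x, y, z]) \<partial>lborel \<partial>lborel \<partial>lborel)"
  proof (rule nn_integral_cong)
    fix x :: real
    have "(\<lambda>p. h (vector [x, fst p, snd p])) \<in> borel_measurable (lborel \<Otimes>\<^sub>M lborel)"
      using measurable_compose[OF measurable_Pair1'[of x lborel "lborel \<Otimes>\<^sub>M lborel"],
          of "\<lambda>p. h (vector [fst p, fst (snd p), snd (snd p)])" borel] by simp
    from lborel.nn_integral_fst[OF this]
    show "(\<integral>\<^sup>+p. h (vector [x, fst p, snd p]) \<partial>(lborel \<Otimes>\<^sub>M lborel)) =
      (\<integral>\<^sup>+y. \<integral>\<^sup>+z. h (vector [x, y, z]) \<partial>lborel \<partial>lborel)" by simp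
  qed
  finally show ?thesis ..
qed

lemma borel_measurable_matrix_vector_mult:
  "(\<lambda>u. A *v u) \<in> borel_measurable borel" for A :: "real^'n^'m"
  by (intro borel_measurable_continuous_onI linear_continuous_on linear_linear[THEN iffD2] matrix_vector_mul_linear)

text \<open>
  Under \<open>u \<mapsto> p + A u\<close> the preimage of a box is its image under the inverse affine map, so its volume
  is the volume of the box divided by \<open>\<bar>det A\<bar>\<close>; boxes determine Lebesgue measure.
\<close>

lemma nn_integral_lborel_affine:
  fixes A :: "real^('n::{finite,wellorder})^('n::_)" and p :: "real^('n::_)"
  assumes det: "det A \<noteq> 0" and h [measurable]: "h \<in> borel_measurable borel"
  shows "(\<integral>\<^sup>+u. h (p + A *v u) \<partial>lborel) = ennreal (1 / \<bar>det A\<bar>) * integral\<^sup>N lborel h"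
proof -
  obtain B where B: "A ** B = mat 1" "B ** A = mat 1"
    using det invertible_det_nz[of A] unfolding invertible_def by blast
  let ?T = "\<lambda>u. p + A *v u"
  have [measurable]: "?T \<in> borel_measurable borel"
    using borel_measurable_matrix_vector_mult[of A] by measurable
  have "lborel = density (distr lborel borel ?T) (\<lambda>_. ennreal \<bar>det A\<bar>)"
  proof (rule lborel_eqI)
    fix l u :: "real^('n::_)"
    assume le: "\<And>b. b \<in> Basis \<Longrightarrow> l \<bullet> b \<le> u \<bullet> b"
    let ?S = "?T -` box l u"
    have "det A * det B = 1" using B(1) by (metis det_I det_mul)
    have "?S = (*v) B ` ((+) (- p) ` box l u)"
    proof (intro equalityI subsetI)
      fix x assume "x \<in> ?S"
      moreover have "x = B *v (- p + (p + A *v x))" using B(2) by (simp add: matrix_vector_mul_assoc)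
      ultimately show "x \<in> (*v) B ` ((+) (- p) ` box l u)" by blast
    next
      fix x assume "x \<in> (*v) B ` ((+) (- p) ` box l u)"
      then show "x \<in> ?S" using B(1) by (auto simp: matrix_vector_mul_assoc)
    qed
    moreover have box: "(+) (- p) ` box l u \<in> lmeasurable"
      by (intro measurable_translation) simp
    ultimately have S: "?S \<in> lmeasurable" "measure lebesgue ?S = \<bar>det B\<bar> * measure lebesgue (box l u)"
      using measurable_linear_image[OF matrix_vector_mul_linear box, of B]
        measure_linear_image[OF matrix_vector_mul_linear box, of B]
      by (simp_all add: measure_translation del: uminus_add_conv_diff)
    have Sb: "?S \<in> sets borel" using measurable_sets[of ?T borel borel "box l u"] by simp
    have "emeasure (distr lborel borel ?T) (box l u) = emeasure lborel ?S"
      by (simp add: emeasure_distr)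
    also have "\<dots> = emeasure lebesgue ?S" using Sb by simp
    also have "\<dots> = ennreal (\<bar>det B\<bar> * measure lebesgue (box l u))"
      using S by (simp add: emeasure_eq_measure2)
    also have "measure lebesgue (box l u) = (\<Prod>b\<in>Basis. (u - l) \<bullet> b)"
      using le by (simp add: measure_def enn2real_ennreal prod_nonneg inner_diff_left)
    finally have *: "emeasure (distr lborel borel ?T) (box l u) = ennreal (\<bar>det B\<bar> * (\<Prod>b\<in>Basis. (u - l) \<bullet> b))" .
    have "emeasure (density (distr lborel borel ?T) (\<lambda>_. ennreal \<bar>det A\<bar>)) (box l u)
       = ennreal \<bar>det A\<bar> * emeasure (distr lborel borel ?T) (box l u)"
      by (subst emeasure_density) (auto simp: nn_integral_cmult)
    also have "\<dots> = ennreal (\<bar>det A\<bar> * (\<bar>det B\<bar> * (\<Prod>b\<in>Basis. (u - l) \<bullet> b)))"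
      unfolding * by (simp add: ennreal_mult')
    also have "\<bar>det A\<bar> * (\<bar>det B\<bar> * (\<Prod>b\<in>Basis. (u - l) \<bullet> b)) = (\<Prod>b\<in>Basis. (u - l) \<bullet> b)"
      using \<open>det A * det B = 1\<close> by (metis abs_mult abs_one mult.assoc mult_1)
    finally show "emeasure (density (distr lborel borel ?T) (\<lambda>_. ennreal \<bar>det A\<bar>)) (box l u) =
      ennreal (\<Prod>b\<in>Basis. (u - l) \<bullet> b)" .
  qed simp
  then have "integral\<^sup>N lborel h = integral\<^sup>N (density (distr lborel borel ?T) (\<lambda>_. ennreal \<bar>det A\<bar>)) h"
    by simp
  also have "\<dots> = ennreal \<bar>det A\<bar> * (\<integral>\<^sup>+u. h (p + A *v u) \<partial>lborel)"
    by (simp add: nn_integral_density nn_integral_distr nn_integral_cmult)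
  finally show ?thesis
    using det by (simp add: mult.assoc[symmetric] ennreal_mult'[symmetric])
qed

section \<open>The linear system for the occupation times\<close>

lemma vector_4:
  "(vector [a, b, d, e] :: 'a::zero^4) $ 1 = a"
  "(vector [a, b, d, e] :: 'a::zero^4) $ 2 = b"
  "(vector [a, b, d, e] :: 'a::zero^4) $ 3 = d"
  "(vector [a, b, d, e] :: 'a::zero^4) $ 4 = e"
  unfolding vector_def by simp_all

lemma sum_1_4: "sum g {1..4::nat} = g 1 + g 2 + g 3 + (g 4 :: 'a::comm_monoid_add)"
  by (simp add: numeral_eq_Suc atLeastAtMostSuc_conv ac_simps)

lemma det_4:
  "det (A::'a::comm_ring_1^4^4) =
    A$1$1 * (A$2$2 * (A$3$3 * A$4$4 - A$3$4 * A$4$3) - A$2$3 * (A$3$2 * A$4$4 - A$3$4 * A$4$2)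
             + A$2$4 * (A$3$2 * A$4$3 - A$3$3 * A$4$2)) -
    A$1$2 * (A$2$1 * (A$3$3 * A$4$4 - A$3$4 * A$4$3) - A$2$3 * (A$3$1 * A$4$4 - A$3$4 * A$4$1)
             + A$2$4 * (A$3$1 * A$4$3 - A$3$3 * A$4$1)) +
    A$1$3 * (A$2$1 * (A$3$2 * A$4$4 - A$3$4 * A$4$2) - A$2$2 * (A$3$1 * A$4$4 - A$3$4 * A$4$1)
             + A$2$4 * (A$3$1 * A$4$2 - A$3$2 * A$4$1)) -
    A$1$4 * (A$2$1 * (A$3$2 * A$4$3 - A$3$3 * A$4$2) - A$2$2 * (A$3$1 * A$4$3 - A$3$3 * A$4$1)
             + A$2$3 * (A$3$1 * A$4$2 - A$3$2 * A$4$1))"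
proof -
  have f1: "finite {2::4, 3, 4}" "1 \<notin> {2::4, 3, 4}" by auto
  have f2: "finite {3::4, 4}" "2 \<notin> {3::4, 4}" by auto
  have f3: "finite {4::4}" "3 \<notin> {4::4}" by auto
  show ?thesis
    unfolding det_def UNIV_4
    unfolding sum_over_permutations_insert[OF f1]
    unfolding sum_over_permutations_insert[OF f2]
    unfolding sum_over_permutations_insert[OF f3]
    unfolding permutes_sing
    by (simp add: sign_swap_id permutation_swap_id permutation_compose sign_compose sign_id swap_id_eq algebra_simps)
qed

lemma motion_matrix_nth:
  "motion_matrix c v $ 1 = vector [c * v 1 $ 1, c * v 2 $ 1, c * v 3 $ 1, c * v 4 $ 1]"
  "motion_matrix c v $ 2 = vector [c * v 1 $ 2, c * v 2 $ 2, c * v 3 $ 2, c * v 4 $ 2]"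
  "motion_matrix c v $ 3 = vector [c * v 1 $ 3, c * v 2 $ 3, c * v 3 $ 3, c * v 4 $ 3]"
  "motion_matrix c v $ 4 = vector [1, 1, 1, 1]"
  by (simp_all add: vec_eq_iff forall_4 motion_matrix_def motion_column_def transpose_def vector_4)

lemma motion_system_iff:
  "motion_matrix c v *v \<tau> = vector [x $ 1, x $ 2, x $ 3, t] \<longleftrightarrow>
     c *\<^sub>R (\<Sum>i=1..4. \<tau> $ of_nat i *\<^sub>R v i) = x \<and> (\<Sum>i=1..4. \<tau> $ of_nat i) = t"
  unfolding vec_eq_iff forall_4 forall_3 sum_1_4
  by (auto simp: matrix_vector_mult_def sum_4 motion_matrix_nth vector_4 algebra_simps)

text \<open>
  Subtracting column \<open>j\<close> of the motion matrix from the other three columns leaves a single \<open>1\<close> in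
  its last row. Expansion along that row leaves the determinant of the three differences, which is
  the Jacobian determinant of the position as a function of the three occupation times other than
  the \<open>j\<close>-th.
\<close>

lemma abs_det_motion_matrix:
  fixes v :: "nat \<Rightarrow> real^3"
  assumes "(j, a, b, d) \<in> {(1,2,3,4), (2,1,3,4), (3,1,2,4), (4,1,2,3)}"
  shows "\<bar>det (motion_matrix c v)\<bar> =
    \<bar>det (\<chi> r. vector [c * (v a - v j) $ r, c * (v b - v j) $ r, c * (v d - v j) $ r] :: real^3^3)\<bar>"
proof -
  let ?D = "det (motion_matrix c v)"
  let ?E = "det (\<chi> r. vector [c * (v a - v j) $ r, c * (v b - v j) $ r, c * (v d - v j) $ r] :: real^3^3)"
  have "?D = - ?E" if "(j, a, b, d) = (1,2,3,4)"
    using that unfolding det_4 det_3 motion_matrix_nth vector_4 by (clarsimp simp: algebra_simps)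
  moreover have "?D = ?E" if "(j, a, b, d) = (2,1,3,4)"
    using that unfolding det_4 det_3 motion_matrix_nth vector_4 by (clarsimp simp: algebra_simps)
  moreover have "?D = - ?E" if "(j, a, b, d) = (3,1,2,4)"
    using that unfolding det_4 det_3 motion_matrix_nth vector_4 by (clarsimp simp: algebra_simps)
  moreover have "?D = ?E" if "(j, a, b, d) = (4,1,2,3)"
    using that unfolding det_4 det_3 motion_matrix_nth vector_4 by (clarsimp simp: algebra_simps)
  ultimately show ?thesis using assms by auto
qed

locale tetrahedral_directions =
  fixes c :: real and v :: "nat \<Rightarrow> real^3"
  assumes c: "c > 0" and inj: "inj_on v {1..4}" and indep: "\<not> affine_dependent (v ` {1..4})"
begin

lemma affine_independent_coeffs_0:
  assumes "(\<Sum>i=1..4. e i *\<^sub>R v i) = 0" "(\<Sum>i=1..4. e i) = 0" "i \<in> {1..4}"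
  shows "e i = 0"
proof (rule ccontr)
  assume "e i \<noteq> 0"
  let ?U = "\<lambda>y. e (the_inv_into {1..4} v y)"
  have *: "?U (v i) = e i" if "i \<in> {1..4}" for i
    using inj that by (simp add: the_inv_into_f_f)
  have "sum ?U (v ` {1..4}) = 0"
    unfolding sum.reindex[OF inj] comp_def using assms * by simp
  moreover have "sum (\<lambda>y. ?U y *\<^sub>R y) (v ` {1..4}) = 0"
    unfolding sum.reindex[OF inj] comp_def using assms * by simp
  moreover have "\<exists>y\<in>v ` {1..4}. ?U y \<noteq> 0"
    using \<open>e i \<noteq> 0\<close> * assms(3) by auto
  ultimately have "affine_dependent (v ` {1..4})"
    by (subst affine_dependent_explicit_finite) auto
  with indep show False ..
qed

lemma motion_matrix_invertible: "invertible (motion_matrix c v)"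
proof -
  have "\<tau> = 0" if "motion_matrix c v *v \<tau> = 0" for \<tau>
  proof -
    have "motion_matrix c v *v \<tau> = vector [(0::real^3) $ 1, (0::real^3) $ 2, (0::real^3) $ 3, 0]"
      unfolding that by (simp add: vec_eq_iff forall_4 vector_4)
    then have "\<tau> $ of_nat i = 0" if "i \<in> {1..4}" for i :: nat
      using affine_independent_coeffs_0[of "\<lambda>i. \<tau> $ of_nat i"] that c
      unfolding motion_system_iff by simp
    from this[of 1] this[of 2] this[of 3] this[of 4] show "\<tau> = 0"
      by (simp add: vec_eq_iff forall_4)
  qed
  then show ?thesis
    unfolding invertible_left_inverse matrix_left_invertible_ker by blast
qed

lemma motion_matrix_inv:
  "matrix_inv (motion_matrix c v) ** motion_matrix c v = mat 1"
  "motion_matrix c v ** matrix_inv (motion_matrix c v) = mat 1"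
  using motion_matrix_invertible unfolding invertible_def matrix_inv_def
  by (metis (mono_tags, lifting) someI_ex)+

lemma tau_eq_matrix_inv:
  "tau c v x t i = (matrix_inv (motion_matrix c v) *v vector [x $ 1, x $ 2, x $ 3, t]) $ of_nat i"
proof -
  let ?A = "motion_matrix c v" and ?z = "vector [x $ 1, x $ 2, x $ 3, t] :: real^4"
  have "(THE \<tau>. ?A *v \<tau> = ?z) = matrix_inv ?A *v ?z"
    using motion_matrix_inv
    by (intro the_equality) (auto simp: matrix_vector_mul_assoc dest!: sym[where s = "?A *v _"])
  then show ?thesis by (simp add: tau_def)
qed

lemma tau_sum: "c *\<^sub>R (\<Sum>i=1..4. tau c v x t i *\<^sub>R v i) = x" "(\<Sum>i=1..4. tau c v x t i) = t"
proof -
  let ?A = "motion_matrix c v" and ?z = "vector [x $ 1, x $ 2, x $ 3, t] :: real^4"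
  have "?A *v (matrix_inv ?A *v ?z) = ?z"
    by (simp add: motion_matrix_inv matrix_vector_mul_assoc)
  then show "c *\<^sub>R (\<Sum>i=1..4. tau c v x t i *\<^sub>R v i) = x" "(\<Sum>i=1..4. tau c v x t i) = t"
    unfolding motion_system_iff tau_eq_matrix_inv by auto
qed

text \<open>
  The usual way to compute \<^const>\<open>tau\<close>: exhibit four coefficients with the right weighted sum and the
  right total.
\<close>

lemma tau_unique:
  assumes "c *\<^sub>R (\<Sum>i=1..4. e i *\<^sub>R v i) = x" "(\<Sum>i=1..4. e i) = t" "i \<in> {1..4}"
  shows "tau c v x t i = e i"
proof -
  have "c *\<^sub>R (\<Sum>i=1..4. (tau c v x t i - e i) *\<^sub>R v i) = 0"
    using tau_sum[of x t] assms by (simp add: algebra_simps sum_subtractf)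
  then have "tau c v x t i - e i = 0"
    using affine_independent_coeffs_0[of "\<lambda>i. tau c v x t i - e i" i] tau_sum[of x t] assms c
    by (simp add: sum_subtractf)
  then show ?thesis by simp
qed

lemma borel_measurable_tau: "(\<lambda>x. tau c v x t i) \<in> borel_measurable borel"
proof -
  have "(\<lambda>x. tau c v x t i) = (\<lambda>x. \<Sum>r\<in>UNIV. matrix_inv (motion_matrix c v) $ of_nat i $ r *
      (if r = 4 then t else if r = 1 then x $ 1 else if r = 2 then x $ 2 else x $ 3))"
    unfolding tau_eq_matrix_inv by (auto simp: fun_eq_iff matrix_vector_mult_def sum_4 vector_4)
  then show ?thesis by (simp add: borel_measurable_continuous_onI)
qed

text \<open>
  The coordinate \<open>\<tau>\<^sub>i / t\<close> is a barycentric coordinate, hence nonnegative on the tetrahedron. It is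
  affine and equals \<open>1\<close> at the vertex \<open>i\<close>. Moving from an interior point a little away from this
  vertex stays inside and decreases the coordinate strictly, so it was positive before.
\<close>

lemma tau_pos:
  assumes t: "t > 0" and x: "x \<in> interior (tetrahedron c v t)" and i: "i \<in> {1..4}"
  shows "tau c v x t i > 0"
proof -
  have nonneg: "tau c v y t i \<ge> 0" if "y \<in> tetrahedron c v t" for y
  proof -
    have fin: "finite ((\<lambda>j. (c * t) *\<^sub>R v j) ` {1..4::nat})" by simp
    have inj': "inj_on (\<lambda>j. (c * t) *\<^sub>R v j) {1..4}"
      using inj c t by (auto simp: inj_on_def)
    obtain u where u: "\<And>y. y \<in> (\<lambda>j. (c * t) *\<^sub>R v j) ` {1..4} \<Longrightarrow> 0 \<le> u y"
      "sum u ((\<lambda>j. (c * t) *\<^sub>R v j) ` {1..4}) = 1"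
      "(\<Sum>z\<in>(\<lambda>j. (c * t) *\<^sub>R v j) ` {1..4}. u z *\<^sub>R z) = y"
      using \<open>y \<in> tetrahedron c v t\<close> unfolding tetrahedron_def convex_hull_finite[OF fin] by blast
    have "tau c v y t i = t * u ((c * t) *\<^sub>R v i)"
    proof (rule tau_unique[OF _ _ i])
      show "c *\<^sub>R (\<Sum>i = 1..4. (t * u ((c * t) *\<^sub>R v i)) *\<^sub>R v i) = y"
        using u(3) unfolding sum.reindex[OF inj'] by (simp add: scaleR_sum_right mult_ac)
      show "(\<Sum>i = 1..4. t * u ((c * t) *\<^sub>R v i)) = t"
        using u(2) unfolding sum.reindex[OF inj'] by (simp add: sum_distrib_left[symmetric])
    qed
    then show ?thesis using u(1)[OF imageI, OF i] t by simp
  qed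
  obtain e where e: "e > 0" "ball x e \<subseteq> tetrahedron c v t"
    using x by (auto simp: mem_interior)
  define w where "w = x - (c * t) *\<^sub>R v i"
  \<comment> \<open>a step that stays within the ball of radius \<open>e\<close>, also when \<open>w = 0\<close>\<close>
  define s where "s = e / (2 * (norm w + 1))"
  have s: "s > 0" "s * norm w < e"
  proof -
    have n: "norm w \<ge> 0" by simp
    show "s > 0" using e n by (simp add: s_def add_nonneg_pos)
    have eq: "s * norm w = e * (norm w / (2 * (norm w + 1)))" by (simp add: s_def)
    have "0 < 2 * (norm w + 1)" "norm w < 2 * (norm w + 1)"
      using n by (simp_all add: add_nonneg_pos)
    then have "norm w / (2 * (norm w + 1)) < 1"
      by (simp only: divide_less_eq_1_pos)
    then have "e * (norm w / (2 * (norm w + 1))) < e * 1"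
      using e by (intro mult_strict_left_mono)
    then show "s * norm w < e" by (simp add: eq)
  qed
  have "x + s *\<^sub>R w \<in> tetrahedron c v t"
    using s e by (intro subsetD[OF e(2)]) (simp add: dist_norm)
  then have "0 \<le> tau c v (x + s *\<^sub>R w) t i" by (rule nonneg)
  moreover have "tau c v (x + s *\<^sub>R w) t i = (\<lambda>k. (1 + s) * tau c v x t k - (if k = i then s * t else 0)) i"
  proof (rule tau_unique[where e = "\<lambda>k. (1 + s) * tau c v x t k - (if k = i then s * t else 0)", OF _ _ i])
    have "(\<Sum>k = 1..4. ((1 + s) * tau c v x t k - (if k = i then s * t else 0)) *\<^sub>R v k)
      = (1 + s) *\<^sub>R (\<Sum>k=1..4. tau c v x t k *\<^sub>R v k) - (\<Sum>k = 1..4. (if k = i then (s * t) *\<^sub>R v k else 0))"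
    proof -
      have "(\<Sum>k = 1..4. ((1 + s) * tau c v x t k - (if k = i then s * t else 0)) *\<^sub>R v k)
        = (\<Sum>k = 1..4. (1 + s) *\<^sub>R (tau c v x t k *\<^sub>R v k) - (if k = i then (s * t) *\<^sub>R v k else 0))"
        by (intro sum.cong) (auto simp: algebra_simps)
      then show ?thesis by (simp only: sum_subtractf scaleR_sum_right)
    qed
    also have "(\<Sum>k = 1..4. (if k = i then (s * t) *\<^sub>R v k else 0)) = (s * t) *\<^sub>R v i"
      using i by simp
    finally have eq: "(\<Sum>k = 1..4. ((1 + s) * tau c v x t k - (if k = i then s * t else 0)) *\<^sub>R v k)
      = (1 + s) *\<^sub>R (\<Sum>k=1..4. tau c v x t k *\<^sub>R v k) - (s * t) *\<^sub>R v i" .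
    have "c *\<^sub>R ((1 + s) *\<^sub>R (\<Sum>k=1..4. tau c v x t k *\<^sub>R v k) - (s * t) *\<^sub>R v i)
      = (1 + s) *\<^sub>R (c *\<^sub>R (\<Sum>k=1..4. tau c v x t k *\<^sub>R v k)) - (s * (c * t)) *\<^sub>R v i"
      by (simp add: algebra_simps)
    then show "c *\<^sub>R (\<Sum>k = 1..4. ((1 + s) * tau c v x t k - (if k = i then s * t else 0)) *\<^sub>R v k) = x + s *\<^sub>R w"
      unfolding eq tau_sum(1) by (simp add: w_def algebra_simps)
    show "(\<Sum>k = 1..4. (1 + s) * tau c v x t k - (if k = i then s * t else 0)) = t"
      unfolding sum_subtractf sum_distrib_left[symmetric] tau_sum using i by (simp add: algebra_simps)
  qed
  ultimately have "s * t \<le> (1 + s) * tau c v x t i" by simp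
  moreover have "0 < s * t" using s t by simp
  ultimately have "0 < (1 + s) * tau c v x t i" by linarith
  then show ?thesis by (rule zero_less_mult_pos) (use s in linarith)
qed

end

section \<open>Geometric counting processes\<close>

abbreviation exp_dist :: "real \<Rightarrow> real measure" where
  "exp_dist a \<equiv> density lborel (\<lambda>x. ennreal (exponential_density a x))"

text \<open>
  Taking expectations in the defining conditional probability: the joint law of the first
  interarrival times is a mixture of products of exponential laws.
\<close>

lemma (in prob_space) gcp_prob_prefix:
  assumes gcp: "gcp_interarrivals M l W"
  obtains \<alpha> where "\<alpha> \<in> borel_measurable M" "AE \<omega> in M. \<alpha> \<omega> > 0"
    "\<forall>n A. (\<forall>k\<in>{1..n}. A k \<in> sets borel) \<longrightarrow>
      prob {\<omega>\<in>space M. \<forall>k\<in>{1..n}. W k \<omega> \<in> A k} =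
      (\<integral>\<omega>. (\<Prod>k=1..n. measure (exp_dist (\<alpha> \<omega>)) (A k)) \<partial>M)"
proof -
  obtain \<alpha> where dist: "distributed M lborel \<alpha> (\<lambda>a. ennreal (exponential_density (1 / l) a))"
    and ce': "\<forall>n A. (\<forall>k\<in>{1..n}. A k \<in> sets borel) \<longrightarrow>
      (AE \<omega> in M. real_cond_exp M (vimage_algebra (space M) \<alpha> borel)
             (indicator {\<omega>\<in>space M. \<forall>k\<in>{1..n}. W k \<omega> \<in> A k}) \<omega> =
           (\<Prod>k=1..n. measure (exp_dist (\<alpha> \<omega>)) (A k)))"
    using gcp unfolding gcp_interarrivals_def by (elim conjE exE) (rule that)
  have W: "W k \<in> borel_measurable M" if "k \<ge> 1" for k
    using gcp that unfolding gcp_interarrivals_def by blast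
  have \<alpha> [measurable]: "\<alpha> \<in> borel_measurable M"
    using distributed_measurable[OF dist] by simp
  have pos: "AE \<omega> in M. \<alpha> \<omega> > 0"
  proof -
    have "AE x in lborel. x \<noteq> (0::real)" by (rule AE_lborel_singleton)
    then have "AE x in density lborel (\<lambda>a. ennreal (exponential_density (1 / l) a)). x > 0"
      by (subst AE_density) (auto simp: exponential_density_def elim!: eventually_mono split: if_splits)
    then have "AE x in distr M lborel \<alpha>. x > 0"
      unfolding distributed_distr_eq_density[OF dist] .
    then show ?thesis
      by (subst (asm) AE_distr_iff) auto
  qed
  have eq: "prob {\<omega>\<in>space M. \<forall>k\<in>{1..n}. W k \<omega> \<in> A k} =
      (\<integral>\<omega>. (\<Prod>k=1..n. measure (exp_dist (\<alpha> \<omega>)) (A k)) \<partial>M)"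
    if A: "\<And>k. k \<in> {1..n} \<Longrightarrow> A k \<in> sets borel" for n A
  proof -
    have ce: "AE \<omega> in M. real_cond_exp M (vimage_algebra (space M) \<alpha> borel)
             (indicator {\<omega>\<in>space M. \<forall>k\<in>{1..n}. W k \<omega> \<in> A k}) \<omega> =
           (\<Prod>k=1..n. measure (exp_dist (\<alpha> \<omega>)) (A k))"
      using ce'[THEN spec[of _ n], THEN spec[of _ A], THEN mp] A by blast
    let ?F = "vimage_algebra (space M) \<alpha> borel"
    let ?E = "{\<omega>\<in>space M. \<forall>k\<in>{1..n}. W k \<omega> \<in> A k}"
    have E: "?E \<in> sets M"
    proof -
      have "?E = (\<Inter>k\<in>{1..n}. W k -` A k \<inter> space M) \<inter> space M" by auto
      also have "\<dots> \<in> sets M"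
        using W A by (cases "n = 0") (auto intro!: sets.Int sets.finite_INT)
      finally show ?thesis .
    qed
    interpret sub: finite_measure_subalgebra M ?F
      by unfold_locales (auto simp: subalgebra_def sets_vimage_algebra2 intro: measurable_sets[OF \<alpha>])
    have "integrable M (indicator ?E :: _ \<Rightarrow> real)"
      by (intro integrable_real_indicator E) (simp add: less_top[symmetric])
    then have "(\<integral>\<omega>. real_cond_exp M ?F (indicator ?E) \<omega> \<partial>M) = (\<integral>\<omega>. indicator ?E \<omega> \<partial>M)"
      by (rule sub.real_cond_exp_int(2))
    also have "\<dots> = prob ?E" using E by simp
    also have "(\<integral>\<omega>. real_cond_exp M ?F (indicator ?E) \<omega> \<partial>M) =
       (\<integral>\<omega>. (\<Prod>k=1..n. measure (exp_dist (\<alpha> \<omega>)) (A k)) \<partial>M)"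
    proof (rule integral_cong_AE[OF _ _ ce])
      show "real_cond_exp M ?F (indicator ?E) \<in> borel_measurable M" by simp
      show "(\<lambda>\<omega>. \<Prod>k=1..n. measure (exp_dist (\<alpha> \<omega>)) (A k))
        \<in> borel_measurable M"
      proof (rule borel_measurable_prod)
        fix k assume "k \<in> {1..n}"
        then have [measurable]: "A k \<in> sets borel" by (rule A)
        show "(\<lambda>\<omega>. measure (exp_dist (\<alpha> \<omega>)) (A k)) \<in> borel_measurable M"
          unfolding measure_def exponential_density_def by (simp add: emeasure_density)
      qed
    qed
    finally show ?thesis ..
  qed
  show ?thesis by (rule that[OF \<alpha> pos]) (intro allI impI eq, rule bspec)
qed

lemma measure_exponential_atMost:
  assumes "a > 0" "s \<ge> 0"
  shows "measure (exp_dist a) {..s} = 1 - exp (- a * s)"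
  using assms by (simp add: measure_def emeasure_erlang_density erlang_CDF_def)

lemma (in prob_space) gcp_AE_pos:
  assumes gcp: "gcp_interarrivals M l W" and k: "k \<ge> 1"
  shows "AE \<omega> in M. W k \<omega> > 0"
proof -
  let ?A = "\<lambda>i. if i = k then {..0::real} else UNIV"
  obtain \<alpha> where \<alpha>: "\<alpha> \<in> borel_measurable M" "AE \<omega> in M. \<alpha> \<omega> > 0"
    "\<forall>n A. (\<forall>k\<in>{1..n}. A k \<in> sets borel) \<longrightarrow>
      prob {\<omega>\<in>space M. \<forall>k\<in>{1..n}. W k \<omega> \<in> A k} =
      (\<integral>\<omega>. (\<Prod>k=1..n. measure (exp_dist (\<alpha> \<omega>)) (A k)) \<partial>M)"
    by (rule gcp_prob_prefix[OF gcp])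
  have [measurable]: "W k \<in> borel_measurable M"
    using gcp k unfolding gcp_interarrivals_def by blast
  have A: "\<forall>i\<in>{1..k}. ?A i \<in> sets borel" by simp
  have 0: "(\<integral>\<omega>. (\<Prod>i=1..k. measure (exp_dist (\<alpha> \<omega>)) (?A i)) \<partial>M) = 0"
  proof (rule integral_eq_zero_AE)
    show "AE \<omega> in M. (\<Prod>i=1..k. measure (exp_dist (\<alpha> \<omega>)) (?A i)) = 0"
      using \<alpha>(2)
    proof eventually_elim
      case (elim \<omega>)
      then have "measure (exp_dist (\<alpha> \<omega>)) (?A k) = 0"
        by (simp add: measure_exponential_atMost)
      with k show ?case by (intro prod_zero bexI[of _ k]) simp_all
    qed
  qed
  have "(\<forall>i\<in>{1..k}. W i \<omega> \<in> ?A i) \<longleftrightarrow> \<not> W k \<omega> > 0" for \<omega>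
  proof
    assume "\<forall>i\<in>{1..k}. W i \<omega> \<in> ?A i"
    from bspec[OF this, of k] k show "\<not> W k \<omega> > 0" by simp
  qed (simp add: not_less)
  moreover have "prob {\<omega>\<in>space M. \<forall>i\<in>{1..k}. W i \<omega> \<in> ?A i} = 0"
    using \<alpha>(3)[THEN spec[of _ k], THEN spec[of _ ?A], THEN mp, OF A] unfolding 0 .
  ultimately have "prob {\<omega>\<in>space M. \<not> W k \<omega> > 0} = 0" by (simp only:)
  then have "emeasure M {\<omega>\<in>space M. \<not> W k \<omega> > 0} = 0" unfolding emeasure_eq_measure by simp
  then show ?thesis by (rule AE_I[OF subset_refl]) measurable
qed

text \<open>
  For a fixed bound \<open>s\<close>, the probability that the first \<open>n\<close> interarrival times stay below \<open>s\<close> is the mean of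
  the \<open>n\<close>-th power of a number below \<open>1\<close>, and tends to \<open>0\<close> by dominated convergence.
\<close>

lemma (in prob_space) gcp_AE_unbounded:
  assumes gcp: "gcp_interarrivals M l W"
  shows "AE \<omega> in M. \<forall>s. \<exists>k\<ge>1. W k \<omega> > s"
proof -
  have W: "k \<ge> 1 \<Longrightarrow> W k \<in> borel_measurable M" for k
    using gcp unfolding gcp_interarrivals_def by blast
  obtain \<alpha> where \<alpha>: "\<alpha> \<in> borel_measurable M" "AE \<omega> in M. \<alpha> \<omega> > 0"
    "\<forall>n A. (\<forall>k\<in>{1..n}. A k \<in> sets borel) \<longrightarrow>
      prob {\<omega>\<in>space M. \<forall>k\<in>{1..n}. W k \<omega> \<in> A k} =
      (\<integral>\<omega>. (\<Prod>k=1..n. measure (exp_dist (\<alpha> \<omega>)) (A k)) \<partial>M)"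
    by (rule gcp_prob_prefix[OF gcp])
  have "AE \<omega> in M. \<exists>k\<ge>1. W k \<omega> > real N" for N
  proof -
    let ?s = "real N"
    let ?E = "\<lambda>n. {\<omega>\<in>space M. \<forall>k\<in>{1..n}. W k \<omega> \<in> {..?s}}"
    let ?b = "\<lambda>\<omega>. measure (exp_dist (\<alpha> \<omega>)) {..?s}"
    have [measurable]: "?b \<in> borel_measurable M"
      using \<alpha>(1) unfolding measure_def exponential_density_def by (simp add: emeasure_density)
    have "(\<lambda>n. \<integral>\<omega>. ?b \<omega> ^ n \<partial>M) \<longlonglongrightarrow> (\<integral>\<omega>. 0 \<partial>M)"
    proof (rule integral_dominated_convergence[where w = "\<lambda>_. 1"])
      show "AE \<omega> in M. (\<lambda>n. ?b \<omega> ^ n) \<longlonglongrightarrow> 0"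
        using \<alpha>(2) by eventually_elim (auto simp: measure_exponential_atMost intro!: LIMSEQ_power_zero)
      show "AE \<omega> in M. norm (?b \<omega> ^ n) \<le> 1" for n
        using \<alpha>(2) by eventually_elim (auto simp: measure_exponential_atMost norm_power intro!: power_le_one)
    qed auto
    moreover have "prob (?E n) = (\<integral>\<omega>. ?b \<omega> ^ n \<partial>M)" for n
    proof -
      have "\<forall>k\<in>{1..n}. {..?s} \<in> sets borel" by simp
      from \<alpha>(3)[THEN spec[of _ n], THEN spec[of _ "\<lambda>_. {..?s}"], THEN mp, OF this]
      have "prob (?E n) = (\<integral>\<omega>. (\<Prod>k=1..n. ?b \<omega>) \<partial>M)" .
      also have "(\<lambda>\<omega>. \<Prod>k=1..n. ?b \<omega>) = (\<lambda>\<omega>. ?b \<omega> ^ n)" by (simp only: prod_constant card_atLeastAtMost) simp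
      finally show ?thesis .
    qed
    ultimately have lim: "(\<lambda>n. prob (?E n)) \<longlonglongrightarrow> 0" by (simp only: integral_zero)
    have W': "{\<omega>\<in>space M. W k \<omega> > ?s} \<in> sets M" if "k \<ge> 1" for k
      using W[OF that] by measurable
    let ?B = "{\<omega>\<in>space M. \<not> (\<exists>k\<ge>1. W k \<omega> > ?s)}"
    have B: "?B \<in> sets M"
    proof -
      have "?B = space M - (\<Union>k\<in>{1..}. {\<omega>\<in>space M. W k \<omega> > ?s})" by auto
      also have "\<dots> \<in> sets M" by (intro sets.Diff sets.top sets.countable_UN'' W') auto
      finally show ?thesis .
    qed
    have E: "?E n \<in> sets M" for n
    proof -
      have "?E n = space M - (\<Union>k\<in>{1..n}. {\<omega>\<in>space M. W k \<omega> > ?s})" by auto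
      also have "\<dots> \<in> sets M" by (intro sets.Diff sets.top sets.countable_UN'' W') auto
      finally show ?thesis .
    qed
    have "prob ?B \<le> prob (?E n)" for n
      by (rule finite_measure_mono[OF _ E]) (auto simp: not_less)
    then have "prob ?B \<le> 0"
      by (intro LIMSEQ_le_const[OF lim]) blast
    then have "prob ?B = 0" by (simp add: measure_le_0_iff)
    then have "emeasure M ?B = 0" unfolding emeasure_eq_measure by simp
    then show ?thesis by (rule AE_I[OF subset_refl _ B])
  qed
  then have "AE \<omega> in M. \<forall>N. \<exists>k\<ge>1. W k \<omega> > real N"
    unfolding AE_all_countable ..
  then show ?thesis
  proof eventually_elim
    case (elim \<omega>)
    show ?case
    proof
      fix s :: real
      obtain N where "s \<le> real N" using real_arch_simple by blast
      moreover obtain k where "k \<ge> 1" "real N < W k \<omega>" using elim by blast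
      ultimately show "\<exists>k\<ge>1. W k \<omega> > s" by (intro exI[of _ k]) linarith
    qed
  qed
qed

section \<open>Deterministic paths with cyclic directions\<close>

text \<open>
  The number of legs along direction \<open>i\<close> among the first \<open>m\<close> legs is \<open>(m + 4 - i) div 4\<close>. Leg
  number \<open>m\<close>, counted from \<open>0\<close>, runs along direction \<open>m mod 4 + 1\<close> in cycle \<open>m div 4 + 1\<close>.
\<close>

lemma completed_phases_div:
  fixes i q s :: nat
  assumes "i \<le> 4"
  shows "(4 * q + s + 4 - i) div 4 = q + (s + 4 - i) div 4"
proof -
  have "4 * q + s + 4 - i = (s + 4 - i) + q * 4" using assms by linarith
  then show ?thesis by (simp only: div_mult_self1[of 4 "s + 4 - i" q, simplified])
qed

lemma completed_phases_Suc:
  fixes i m :: nat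
  assumes "i \<in> {1..4}"
  shows "(Suc m + 4 - i) div 4 = (if i = m mod 4 + 1 then Suc (m div 4) else (m + 4 - i) div 4)"
    and "i = m mod 4 + 1 \<Longrightarrow> (m + 4 - i) div 4 = m div 4"
proof -
  define q r where "q = m div 4" and "r = m mod 4"
  have r: "r < 4" by (simp add: r_def)
  have i: "1 \<le> i" "i \<le> 4" using assms by auto
  have m: "4 * q + r = m" "4 * q + (r + 1) = Suc m" by (simp_all add: q_def r_def)
  note div = completed_phases_div[OF i(2), of q r, unfolded m] completed_phases_div[OF i(2), of q "r + 1", unfolded m]
  have "(r + 4 - i) div 4 = (if i \<le> r then 1 else 0)" "(r + 1 + 4 - i) div 4 = (if i \<le> r + 1 then 1 else 0)"
    using r i by (auto intro!: div_nat_eqI)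
  then show "(Suc m + 4 - i) div 4 = (if i = m mod 4 + 1 then Suc (m div 4) else (m + 4 - i) div 4)"
    "i = m mod 4 + 1 \<Longrightarrow> (m + 4 - i) div 4 = m div 4"
    unfolding div q_def[symmetric] r_def[symmetric] by (simp_all split: if_splits)
qed

text \<open>
  Number of finished legs along \<open>i \<noteq> j\<close> while leg number \<open>k + 1\<close> along \<open>j\<close> is running.
\<close>

definition legs :: "nat \<Rightarrow> nat \<Rightarrow> nat \<Rightarrow> nat" where
  "legs j k i = (if i < j then k + 1 else k)"

lemma completed_phases:
  assumes "i \<in> {1..4}" "j \<in> {1..4}"
  shows "(4 * k + j - 1 + 4 - i) div 4 = legs j k i"
proof -
  obtain r where r: "j = Suc r" "r < 4" using assms(2) by (cases j) auto
  have "(4 * k + r + 4 - i) div 4 = k + (r + 4 - i) div 4"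
    using assms(1) by (intro completed_phases_div) simp
  also have "(r + 4 - i) div 4 = (if i \<le> r then 1 else 0)"
    using r assms(1) by (auto intro!: div_nat_eqI)
  finally show ?thesis by (simp add: r(1) legs_def less_Suc_eq_le)
qed

text \<open>
  With \<open>g = 1\<close> this is the recurrence of the switching times, with \<open>g = v\<close> that of the positions
  at the switching times.
\<close>

lemma phases_Suc:
  fixes g :: "nat \<Rightarrow> 'b::real_vector"
  shows "(\<Sum>i=1..4. partial_duration D i ((Suc m + 4 - i) div 4) \<omega> *\<^sub>R g i) =
    (\<Sum>i=1..4. partial_duration D i ((m + 4 - i) div 4) \<omega> *\<^sub>R g i) +
      D (m mod 4 + 1) (m div 4 + 1) \<omega> *\<^sub>R g (m mod 4 + 1)"
proof -
  have "(\<Sum>i=1..4. partial_duration D i ((Suc m + 4 - i) div 4) \<omega> *\<^sub>R g i) =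
    (\<Sum>i=1..4. partial_duration D i ((m + 4 - i) div 4) \<omega> *\<^sub>R g i +
      (if i = m mod 4 + 1 then D i (m div 4 + 1) \<omega> *\<^sub>R g i else 0))"
  proof (rule sum.cong[OF refl])
    fix i :: nat assume "i \<in> {1..4}"
    note * = completed_phases_Suc[OF this, of m]
    show "partial_duration D i ((Suc m + 4 - i) div 4) \<omega> *\<^sub>R g i =
        partial_duration D i ((m + 4 - i) div 4) \<omega> *\<^sub>R g i +
        (if i = m mod 4 + 1 then D i (m div 4 + 1) \<omega> *\<^sub>R g i else 0)"
      unfolding *(1) using *(2) by (simp add: partial_duration_def algebra_simps)
  qed
  moreover have "m mod 4 \<le> 3" using mod_less_divisor[of 4 m] by linarith
  ultimately show ?thesis by (simp add: sum.distrib)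
qed

lemma switching_time_eq:
  "switching_time D m \<omega> = (\<Sum>i=1..4. partial_duration D i ((m + 4 - i) div 4) \<omega>)"
proof (cases m)
  case 0
  then show ?thesis by (simp add: switching_time_def partial_duration_def)
next
  case (Suc p)
  let ?j = "p mod 4 + 1"
  let ?g = "\<lambda>i. partial_duration D i ((m + 4 - i) div 4) \<omega>"
  have j: "?j \<le> 4" by (simp add: Suc_le_eq)
  have div: "(m + 4 - i) div 4 = (if i \<le> ?j then p div 4 + 1 else p div 4)" if "i \<in> {1..4}" for i
  proof -
    define q r where "q = p div 4" and "r = p mod 4"
    have r: "r < 4" by (simp add: r_def)
    have i: "1 \<le> i" "i \<le> 4" using that by auto
    have m: "4 * q + (r + 1) = m" by (simp add: q_def r_def Suc)
    have "(r + 1 + 4 - i) div 4 = (if i \<le> r + 1 then 1 else 0)"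
      using r i by (auto intro!: div_nat_eqI)
    then show ?thesis
      using completed_phases_div[OF i(2), of q "r + 1"] unfolding m q_def[symmetric] r_def[symmetric] by simp
  qed
  have "(\<Sum>i=1..4. ?g i) = (\<Sum>i=1..?j. ?g i) + (\<Sum>i=?j+1..4. ?g i)"
    using sum.ub_add_nat[of 1 ?j ?g "4 - ?j"] j by simp
  also have "(\<Sum>i=1..?j. ?g i) = (\<Sum>i=1..?j. partial_duration D i (p div 4 + 1) \<omega>)"
    using j by (intro sum.cong[OF refl]) (subst div, auto)
  also have "(\<Sum>i=?j+1..4. ?g i) = (\<Sum>i=?j+1..4. partial_duration D i (p div 4) \<omega>)"
    by (intro sum.cong[OF refl]) (subst div, auto)
  finally show ?thesis by (simp add: switching_time_def Suc Let_def)
qed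

lemma switching_time_0: "switching_time D 0 \<omega> = 0"
  by (simp add: switching_time_def)

lemma switching_time_Suc:
  "switching_time D (Suc m) \<omega> = switching_time D m \<omega> + D (m mod 4 + 1) (m div 4 + 1) \<omega>"
  using phases_Suc[of D m \<omega> "\<lambda>_. 1::real"] by (simp add: switching_time_eq)

lemma has_bochner_integral_indicator_Ico:
  "(a::real) \<le> b \<Longrightarrow> has_bochner_integral lborel (indicator {a..<b}) (b - a)"
  using has_bochner_integral_real_indicator[of "{a..<b}" lborel] by simp

lemma has_bochner_integral_indicator_Icc:
  "(a::real) \<le> b \<Longrightarrow> has_bochner_integral lborel (indicator {a..b}) (b - a)"
  using has_bochner_integral_real_indicator[of "{a..b}" lborel] by simp

text \<open>
  The properties of almost every path that make \<^const>\<open>velocity\<close> well defined. Long durations in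
  direction \<open>1\<close> alone already force the switching times to be unbounded.
\<close>

locale regular_path =
  fixes D :: "nat \<Rightarrow> nat \<Rightarrow> 'a \<Rightarrow> real" and \<omega> :: 'a
  assumes pos: "i \<in> {1..4} \<Longrightarrow> k \<ge> 1 \<Longrightarrow> D i k \<omega> > 0"
    and unbounded: "\<exists>k\<ge>1. D 1 k \<omega> > s"
begin

abbreviation "T m \<equiv> switching_time D m \<omega>"

lemma T_Suc_gt: "T m < T (Suc m)"
  unfolding switching_time_Suc using pos[of "m mod 4 + 1" "m div 4 + 1"] by simp

lemma T_strict_mono: "strict_mono T"
  by (rule strict_monoI_Suc) (rule T_Suc_gt)

lemma partial_duration_nonneg: "i \<in> {1..4} \<Longrightarrow> partial_duration D i k \<omega> \<ge> 0"
  unfolding partial_duration_def using pos by (intro sum_nonneg) (auto intro: less_imp_le)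

lemma T_unbounded: "\<exists>m. T m > s"
proof -
  obtain k where k: "k \<ge> 1" "D 1 k \<omega> > s" using unbounded by blast
  have "D 1 k \<omega> \<le> partial_duration D 1 k \<omega>"
    unfolding partial_duration_def using k pos by (intro member_le_sum) (auto intro: less_imp_le)
  also have "\<dots> = partial_duration D 1 ((4 * k + 4 - 1) div 4) \<omega>" by simp
  also have "\<dots> \<le> T (4 * k)"
    unfolding switching_time_eq by (rule member_le_sum) (auto intro: partial_duration_nonneg)
  finally show ?thesis using k by (intro exI[of _ "4 * k"]) linarith
qed

lemma phase_exists:
  assumes "t \<ge> 0"
  obtains m where "T m \<le> t" "t < T (Suc m)"
proof -
  define n where "n = (LEAST m. t < T m)"
  have n: "t < T n" unfolding n_def by (rule LeastI_ex) (rule T_unbounded)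
  have "n \<noteq> 0" using n assms by (auto simp: switching_time_0 intro: ccontr)
  then obtain m where m: "n = Suc m" by (cases n) auto
  then have "\<not> t < T m" using not_less_Least[of m "\<lambda>m. t < T m"] unfolding n_def by simp
  with n m that[of m] show ?thesis by simp
qed

lemma phase_unique:
  assumes "T m \<le> t" "t < T (Suc m)" "T n \<le> t" "t < T (Suc n)"
  shows "m = n"
proof -
  have "m < Suc n" "n < Suc m"
    using assms unfolding strict_mono_less[OF T_strict_mono, symmetric] by linarith+
  then show ?thesis by simp
qed

lemma velocity_in_phase:
  assumes "T m \<le> s" "s < T (Suc m)"
  shows "velocity v D s \<omega> = v (m mod 4 + 1)"
proof -
  have "(THE j. j \<in> {1..4} \<and> (\<exists>n. T (4 * n + j - 1) \<le> s \<and> s < T (4 * n + j))) = m mod 4 + 1"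
  proof (rule the_equality)
    have "4 * (m div 4) + (m mod 4 + 1) - 1 = m" "4 * (m div 4) + (m mod 4 + 1) = Suc m" by simp_all
    then show "m mod 4 + 1 \<in> {1..4} \<and>
      (\<exists>n. T (4 * n + (m mod 4 + 1) - 1) \<le> s \<and> s < T (4 * n + (m mod 4 + 1)))"
      using assms by (intro conjI exI[of _ "m div 4"]) auto
  next
    fix j assume j: "j \<in> {1..4} \<and> (\<exists>n. T (4 * n + j - 1) \<le> s \<and> s < T (4 * n + j))"
    then obtain n where n: "T (4 * n + j - 1) \<le> s" "s < T (4 * n + j)" by blast
    have Suc: "Suc (4 * n + j - 1) = 4 * n + j" using j by simp
    have "m = 4 * n + j - 1" using n(2) by (intro phase_unique[OF assms n(1)]) (simp only: Suc)
    moreover obtain i where "j = Suc i" "i < 4" using j by (cases j) auto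
    ultimately show "j = m mod 4 + 1" by simp
  qed
  then show ?thesis by (simp add: velocity_def)
qed

lemma velocity_eq_iff:
  assumes "inj_on v {1..4}" "j \<in> {1..4}" "t \<ge> 0"
  shows "velocity v D t \<omega> = v j \<longleftrightarrow> (\<exists>k. T (4 * k + j - 1) \<le> t \<and> t < T (4 * k + j))"
proof
  assume v: "velocity v D t \<omega> = v j"
  obtain m where m: "T m \<le> t" "t < T (Suc m)" using phase_exists[OF assms(3)] .
  have "v (m mod 4 + 1) = v j" using v velocity_in_phase[OF m] by simp
  then have "m mod 4 + 1 = j" using assms(2) by (intro inj_onD[OF assms(1)]) auto
  then have "4 * (m div 4) + j - 1 = m" "4 * (m div 4) + j = Suc m" by auto
  with m show "\<exists>k. T (4 * k + j - 1) \<le> t \<and> t < T (4 * k + j)"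
    by (intro exI[of _ "m div 4"]) (simp only: simp_thms)
next
  assume "\<exists>k. T (4 * k + j - 1) \<le> t \<and> t < T (4 * k + j)"
  then obtain k where k: "T (4 * k + j - 1) \<le> t" "t < T (4 * k + j)" by blast
  have *: "Suc (4 * k + j - 1) = 4 * k + j" "(4 * k + j - 1) mod 4 + 1 = j"
  proof -
    obtain i where "j = Suc i" "i < 4" using assms(2) by (cases j) auto
    then show "Suc (4 * k + j - 1) = 4 * k + j" "(4 * k + j - 1) mod 4 + 1 = j" by simp_all
  qed
  show "velocity v D t \<omega> = v j"
    using velocity_in_phase[of "4 * k + j - 1" t v] k unfolding * by simp
qed

lemma velocity_integral_phase:
  "has_bochner_integral lborel (\<lambda>s. indicator {0..<T m} s *\<^sub>R velocity v D s \<omega>)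
     (\<Sum>i=1..4. partial_duration D i ((m + 4 - i) div 4) \<omega> *\<^sub>R v i)"
proof (induction m)
  case 0
  then show ?case
    by (simp add: switching_time_0 partial_duration_def has_bochner_integral_zero)
next
  case (Suc m)
  have 0: "0 \<le> T m" using strict_mono_less_eq[OF T_strict_mono, of 0 m] by (simp add: switching_time_0)
  have "has_bochner_integral lborel (\<lambda>s. indicator {T m..<T (Suc m)} s *\<^sub>R v (m mod 4 + 1))
     ((T (Suc m) - T m) *\<^sub>R v (m mod 4 + 1))"
    using T_Suc_gt[of m]
    by (intro has_bochner_integral_scaleR_left has_bochner_integral_indicator_Ico) simp
  from has_bochner_integral_add[OF Suc this]
  have "has_bochner_integral lborel
     (\<lambda>s. indicator {0..<T m} s *\<^sub>R velocity v D s \<omega> + indicator {T m..<T (Suc m)} s *\<^sub>R v (m mod 4 + 1))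
     (\<Sum>i=1..4. partial_duration D i ((Suc m + 4 - i) div 4) \<omega> *\<^sub>R v i)"
    unfolding phases_Suc switching_time_Suc by simp
  also have "(\<lambda>s. indicator {0..<T m} s *\<^sub>R velocity v D s \<omega> + indicator {T m..<T (Suc m)} s *\<^sub>R v (m mod 4 + 1))
    = (\<lambda>s. indicator {0..<T (Suc m)} s *\<^sub>R velocity v D s \<omega>)"
    using 0 T_Suc_gt[of m] by (auto simp: fun_eq_iff velocity_in_phase split: split_indicator)
  finally show ?case .
qed

lemma position_in_phase:
  assumes "T m \<le> t" "t < T (Suc m)"
  shows "position c v D t \<omega> = c *\<^sub>R ((\<Sum>i=1..4. partial_duration D i ((m + 4 - i) div 4) \<omega> *\<^sub>R v i)
    + (t - T m) *\<^sub>R v (m mod 4 + 1))"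
proof -
  have 0: "0 \<le> T m" using strict_mono_less_eq[OF T_strict_mono, of 0 m] by (simp add: switching_time_0)
  have "has_bochner_integral lborel (\<lambda>s. indicator {T m..t} s *\<^sub>R v (m mod 4 + 1))
     ((t - T m) *\<^sub>R v (m mod 4 + 1))"
    using assms(1)
    by (intro has_bochner_integral_scaleR_left has_bochner_integral_indicator_Icc) simp
  from has_bochner_integral_add[OF velocity_integral_phase[of m v] this]
  have "has_bochner_integral lborel
     (\<lambda>s. indicator {0..<T m} s *\<^sub>R velocity v D s \<omega> + indicator {T m..t} s *\<^sub>R v (m mod 4 + 1))
     ((\<Sum>i=1..4. partial_duration D i ((m + 4 - i) div 4) \<omega> *\<^sub>R v i) + (t - T m) *\<^sub>R v (m mod 4 + 1))" .
  also have "(\<lambda>s. indicator {0..<T m} s *\<^sub>R velocity v D s \<omega> + indicator {T m..t} s *\<^sub>R v (m mod 4 + 1))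
    = (\<lambda>s. indicator {0..t} s *\<^sub>R velocity v D s \<omega>)"
    using 0 assms by (auto simp: fun_eq_iff velocity_in_phase split: split_indicator)
  finally show ?thesis
    unfolding position_def set_lebesgue_integral_def by (simp add: has_bochner_integral_integral_eq)
qed

end

section \<open>Measurability of velocity and position\<close>

context
  fixes M :: "'a measure" and D :: "nat \<Rightarrow> nat \<Rightarrow> 'a \<Rightarrow> real" and v :: "nat \<Rightarrow> real^3"
  assumes D: "\<And>i k. i \<in> {1..4} \<Longrightarrow> k \<ge> 1 \<Longrightarrow> D i k \<in> borel_measurable M"
begin

lemma measurable_partial_duration:
  "i \<in> {1..4} \<Longrightarrow> (\<lambda>\<omega>. partial_duration D i k \<omega>) \<in> borel_measurable M"
  unfolding partial_duration_def using D by (intro borel_measurable_sum) auto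

lemma measurable_switching_time: "(\<lambda>\<omega>. switching_time D m \<omega>) \<in> borel_measurable M"
  unfolding switching_time_eq by (intro borel_measurable_sum measurable_partial_duration)

text \<open>
  The direction index is a definite description, which has no useful value where no index or
  several indices qualify. It depends only on which of the four indices qualify, so the velocity is
  a finite sum over the \<open>16\<close> possible sets of qualifying indices. This makes it measurable
  everywhere, including the exceptional null set; the underlying measure need not be complete.
\<close>

lemma measurable_velocity_pair:
  "(\<lambda>(\<omega>, s). velocity v D s \<omega>) \<in> borel_measurable (M \<Otimes>\<^sub>M borel)"
proof -
  note [measurable] = measurable_switching_time
  define P where "P j x \<longleftrightarrow> j \<in> {1..4::nat} \<and> (\<exists>n. switching_time D (4 * n + j - 1) (fst x) \<le> snd x \<and>
    snd x < switching_time D (4 * n + j) (fst x))" for j and x :: "'a \<times> real"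
  have P [measurable]: "Measurable.pred (M \<Otimes>\<^sub>M borel) (P j)" for j
    unfolding P_def by measurable
  have *: "velocity v D s \<omega> =
    (\<Sum>S\<in>Pow {1..4}. indicator {x. \<forall>j\<in>{1..4}. P j x \<longleftrightarrow> j \<in> S} (\<omega>, s) *\<^sub>R v (THE j. j \<in> S))" for s \<omega>
  proof -
    have "(\<Sum>S\<in>Pow {1..4}. indicator {x. \<forall>j\<in>{1..4}. P j x \<longleftrightarrow> j \<in> S} (\<omega>, s) *\<^sub>R v (THE j. j \<in> S)) =
      (\<Sum>S\<in>Pow {1..4}. if S = {j. P j (\<omega>, s)} then v (THE j. j \<in> S) else 0)"
    proof (rule sum.cong[OF refl])
      fix S :: "nat set" assume "S \<in> Pow {1..4}"
      then have "(\<forall>j\<in>{1..4}. P j (\<omega>, s) \<longleftrightarrow> j \<in> S) \<longleftrightarrow> S = {j. P j (\<omega>, s)}"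
        unfolding P_def by blast
      then show "indicator {x. \<forall>j\<in>{1..4}. P j x \<longleftrightarrow> j \<in> S} (\<omega>, s) *\<^sub>R v (THE j. j \<in> S) =
        (if S = {j. P j (\<omega>, s)} then v (THE j. j \<in> S) else 0)"
        by (simp add: indicator_def)
    qed
    also have "\<dots> = v (THE j. P j (\<omega>, s))"
      by (subst sum.delta) (auto simp: P_def)
    finally show ?thesis by (simp add: velocity_def P_def)
  qed
  have "(\<lambda>x. \<Sum>S\<in>Pow {1..4}. indicator {x. \<forall>j\<in>{1..4}. P j x \<longleftrightarrow> j \<in> S} x *\<^sub>R v (THE j. j \<in> S))
    \<in> borel_measurable (M \<Otimes>\<^sub>M borel)"
  proof (intro borel_measurable_sum borel_measurable_scaleR borel_measurable_const)
    fix S :: "nat set"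
    show "indicator {x. \<forall>j\<in>{1..4}. P j x \<longleftrightarrow> j \<in> S} \<in> borel_measurable (M \<Otimes>\<^sub>M borel)"
      by measurable
  qed
  then show ?thesis by (simp add: * case_prod_beta)
qed

lemma measurable_velocity: "velocity v D t \<in> borel_measurable M"
  using measurable_compose[OF measurable_Pair2'[of t borel M] measurable_velocity_pair] by simp

lemma measurable_position: "position c v D t \<in> borel_measurable M"
proof -
  have "(\<lambda>(\<omega>, s). indicator {0..t} s *\<^sub>R velocity v D s \<omega>) \<in> borel_measurable (M \<Otimes>\<^sub>M lborel)"
    using measurable_velocity_pair by (simp add: case_prod_beta cong: measurable_cong_sets)
  from lborel.borel_measurable_lebesgue_integral[OF this] show ?thesis
    unfolding position_def[abs_def] set_lebesgue_integral_def by simp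
qed

end

section \<open>Survival probabilities from a regular conditional distribution\<close>

text \<open>
  A regular conditional distribution is specified on rectangles. It integrates every measurable set
  of the plane correctly, since rectangles are an intersection-stable generator.
\<close>

lemma (in prob_space) emeasure_joint_kernel:
  fixes X Y :: "'a \<Rightarrow> real"
  assumes [measurable]: "X \<in> borel_measurable M" "Y \<in> borel_measurable M"
    and K: "K \<in> borel \<rightarrow>\<^sub>M prob_algebra borel"
    and rect: "\<And>A B. A \<in> sets borel \<Longrightarrow> B \<in> sets borel \<Longrightarrow>
      emeasure M {\<omega>\<in>space M. X \<omega> \<in> A \<and> Y \<omega> \<in> B} = (\<integral>\<^sup>+u\<in>A. emeasure (K u) B \<partial>distr M borel X)"
    and C [measurable]: "C \<in> sets (borel \<Otimes>\<^sub>M borel)"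
  shows "emeasure M {\<omega>\<in>space M. (X \<omega>, Y \<omega>) \<in> C} = (\<integral>\<^sup>+u. emeasure (K u) (Pair u -` C) \<partial>distr M borel X)"
proof -
  let ?BB = "borel \<Otimes>\<^sub>M borel :: (real \<times> real) measure"
  let ?N1 = "distr M ?BB (\<lambda>\<omega>. (X \<omega>, Y \<omega>))"
  let ?L = "\<lambda>u. distr (K u) ?BB (Pair u)"
  let ?N2 = "distr M borel X \<bind> ?L"
  have K' [measurable]: "K \<in> borel \<rightarrow>\<^sub>M subprob_algebra borel"
    using K by (rule measurable_prob_algebraD)
  have sK [measurable_cong]: "sets (K u) = sets borel" for u
    using measurable_space[OF K, of u] by (simp add: space_prob_algebra)
  have L: "?L \<in> distr M borel X \<rightarrow>\<^sub>M subprob_algebra ?BB"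
    by (rule measurable_distr2[where M = borel]) (auto simp: case_prod_beta)
  have eL: "emeasure (?L u) S = emeasure (K u) (Pair u -` S)" if "S \<in> sets ?BB" for u S
    using that by (subst emeasure_distr) (auto simp: sets_eq_imp_space_eq[OF sK])
  have eN2: "emeasure ?N2 S = (\<integral>\<^sup>+u. emeasure (K u) (Pair u -` S) \<partial>distr M borel X)" if "S \<in> sets ?BB" for S
    using that L not_empty by (subst emeasure_bind[where N = ?BB]) (auto simp: eL)
  have "?N1 = ?N2"
  proof (rule measure_eqI_generator_eq)
    show "Int_stable {a \<times> b |a b. a \<in> sets (borel::real measure) \<and> b \<in> sets (borel::real measure)}"
      by (rule Int_stable_pair_measure_generator)
    show "{a \<times> b |a b. a \<in> sets (borel::real measure) \<and> b \<in> sets (borel::real measure)} \<subseteq> Pow UNIV" by simp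
    show "sets ?N1 = sigma_sets UNIV {a \<times> b |a b. a \<in> sets (borel::real measure) \<and> b \<in> sets (borel::real measure)}"
      by (simp add: sets_pair_measure)
    show "sets ?N2 = sigma_sets UNIV {a \<times> b |a b. a \<in> sets (borel::real measure) \<and> b \<in> sets (borel::real measure)}"
      by (subst sets_bind[where N = ?BB]) (simp_all add: sets_pair_measure not_empty)
    show "range (\<lambda>i::nat. UNIV) \<subseteq> {a \<times> b |a b. a \<in> sets (borel::real measure) \<and> b \<in> sets (borel::real measure)}"
      by (auto intro!: exI[of _ UNIV])
    show "(\<Union>i::nat. UNIV) = (UNIV :: (real \<times> real) set)" by simp
    have "UNIV \<in> sets ?BB" using sets.top[of ?BB] by (simp add: space_pair_measure)
    then show "emeasure ?N1 UNIV \<noteq> \<infinity>"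
      by (subst emeasure_distr) auto
    fix S :: "(real \<times> real) set"
    assume "S \<in> {a \<times> b |a b. a \<in> sets borel \<and> b \<in> sets borel}"
    then obtain a b where S: "S = a \<times> b" and ab [measurable]: "a \<in> sets borel" "b \<in> sets borel" by auto
    have "emeasure ?N1 S = emeasure M {\<omega>\<in>space M. X \<omega> \<in> a \<and> Y \<omega> \<in> b}"
      unfolding S by (subst emeasure_distr) (auto intro!: arg_cong[where f = "emeasure M"])
    also have "\<dots> = (\<integral>\<^sup>+u\<in>a. emeasure (K u) b \<partial>distr M borel X)" by (rule rect) fact+
    also have "\<dots> = (\<integral>\<^sup>+u. emeasure (K u) (Pair u -` S) \<partial>distr M borel X)"
      by (intro nn_integral_cong) (auto simp: S indicator_def)
    also have "\<dots> = emeasure ?N2 S"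
      by (rule eN2[symmetric]) (simp add: S)
    finally show "emeasure ?N1 S = emeasure ?N2 S" .
  qed
  then have "emeasure ?N1 C = emeasure ?N2 C" by simp
  then show ?thesis
    unfolding eN2[OF C] by (subst (asm) emeasure_distr) (auto simp: vimage_def Int_def conj_commute)
qed

text \<open>
  With \<open>u = s - (t - y)\<close> the integral becomes the integral over \<open>0 \<le> u \<le> y\<close> of the density of \<open>X\<close>
  times the conditional probability that \<open>Y\<close> exceeds \<open>y - u\<close>.
\<close>

lemma (in prob_space) survival_integral_eq:
  fixes X Y :: "'a \<Rightarrow> real"
  assumes X: "distributed M lborel X f" and Y: "Y \<in> borel_measurable M"
    and G: "is_cond_survival M Y X G" and pos: "AE \<omega> in M. X \<omega> \<ge> 0"
  shows "(\<integral>\<^sup>+s\<in>{t - y..t}. f (s - (t - y)) * ennreal (G (t - s) (s - (t - y))) \<partial>lborel) =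
    emeasure M {\<omega>\<in>space M. X \<omega> \<le> y \<and> y < X \<omega> + Y \<omega>}"
proof -
  obtain K where K: "K \<in> borel \<rightarrow>\<^sub>M prob_algebra borel"
    and rect: "\<And>A B. A \<in> sets borel \<Longrightarrow> B \<in> sets borel \<Longrightarrow>
      emeasure M {\<omega>\<in>space M. X \<omega> \<in> A \<and> Y \<omega> \<in> B} = (\<integral>\<^sup>+u\<in>A. emeasure (K u) B \<partial>distr M borel X)"
    and GK: "\<And>s u. G s u = measure (K u) {s<..}"
    using G unfolding is_cond_survival_def by blast
  have X' [measurable]: "X \<in> borel_measurable M" using distributed_measurable[OF X] by simp
  have f [measurable]: "f \<in> borel_measurable borel" using distributed_borel_measurable[OF X] by simp
  note Y [measurable]
  have K' [measurable]: "K \<in> borel \<rightarrow>\<^sub>M subprob_algebra borel"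
    using K by (rule measurable_prob_algebraD)
  have G': "ennreal (G s u) = emeasure (K u) {s<..}" for s u
  proof -
    interpret K: prob_space "K u" using measurable_space[OF K, of u] by (simp add: space_prob_algebra)
    show ?thesis by (simp add: GK K.emeasure_eq_measure)
  qed
  have meas [measurable]: "(\<lambda>u. emeasure (K u) {y - u<..}) \<in> borel_measurable borel"
  proof (rule emeasure_measurable_subprob_algebra2[OF _ K'])
    have "(SIGMA u:space borel. {y - u<..}) = {p\<in>space (borel \<Otimes>\<^sub>M borel). y < fst p + snd p}"
      by (auto simp: space_pair_measure)
    also have "\<dots> \<in> sets (borel \<Otimes>\<^sub>M borel)" by measurable
    finally show "(SIGMA u:space borel. {y - u<..}) \<in> sets (borel \<Otimes>\<^sub>M borel)" .
  qed
  define C where "C = {p :: real \<times> real. 0 \<le> fst p \<and> fst p \<le> y \<and> y < fst p + snd p}"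
  have C: "C \<in> sets (borel \<Otimes>\<^sub>M borel)"
  proof -
    have "C = {p\<in>space (borel \<Otimes>\<^sub>M borel). 0 \<le> fst p \<and> fst p \<le> y \<and> y < fst p + snd p}"
      by (auto simp: C_def space_pair_measure)
    also have "\<dots> \<in> sets (borel \<Otimes>\<^sub>M borel)" by measurable
    finally show ?thesis .
  qed
  \<comment> \<open>the integrand after the substitution \<open>u = s - (t - y)\<close>\<close>
  define h where "h u = f u * (emeasure (K u) {y - u<..} * indicator {0..y} u)" for u
  have h [measurable]: "h \<in> borel_measurable borel" unfolding h_def by measurable
  have "emeasure M {\<omega>\<in>space M. X \<omega> \<le> y \<and> y < X \<omega> + Y \<omega>} = emeasure M {\<omega>\<in>space M. (X \<omega>, Y \<omega>) \<in> C}"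
    using pos by (intro emeasure_eq_AE) (auto simp: C_def)
  also have "\<dots> = (\<integral>\<^sup>+u. emeasure (K u) (Pair u -` C) \<partial>distr M borel X)"
    by (rule emeasure_joint_kernel[OF X' Y K rect C])
  also have "\<dots> = (\<integral>\<^sup>+u. emeasure (K u) {y - u<..} * indicator {0..y} u \<partial>distr M lborel X)"
  proof -
    have "distr M borel X = distr M lborel X" by (rule distr_cong) auto
    moreover have "emeasure (K u) (Pair u -` C) = emeasure (K u) {y - u<..} * indicator {0..y} u" for u
    proof -
      have "Pair u -` C = (if u \<in> {0..y} then {y - u<..} else {})" by (auto simp: C_def)
      then show ?thesis by simp
    qed
    ultimately show ?thesis by simp
  qed
  also have "\<dots> = integral\<^sup>N lborel h"
    unfolding distributed_distr_eq_density[OF X] h_def by (subst nn_integral_density) auto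
  also have "\<dots> = (\<integral>\<^sup>+s. h (s - (t - y)) \<partial>lborel)"
    using nn_integral_real_affine[OF h, of 1 "- (t - y)"] by (simp add: algebra_simps)
  also have "\<dots> = (\<integral>\<^sup>+s\<in>{t - y..t}. f (s - (t - y)) * ennreal (G (t - s) (s - (t - y))) \<partial>lborel)"
    unfolding G' h_def
    by (intro nn_integral_cong) (auto simp: algebra_simps indicator_def)
  finally show ?thesis ..
qed

section \<open>Iterated integration over four independent components\<close>

text \<open>
  Independence turns one expectation into four nested ones over independent copies of the sample
  space. Keeping all of them on \<open>M\<close> lets densities be substituted one variable at a time.
\<close>

lemma (in prob_space) nn_integral_indep_vars4:
  fixes X :: "'i \<Rightarrow> 'a \<Rightarrow> 'b"
  assumes indep: "indep_vars (\<lambda>_. S) X {a, b, d, j}" and dist: "distinct [a, b, d, j]"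
    and F: "(\<lambda>(w1, w2, w3, w4). F w1 w2 w3 w4) \<in> borel_measurable (S \<Otimes>\<^sub>M S \<Otimes>\<^sub>M S \<Otimes>\<^sub>M S)"
  shows "(\<integral>\<^sup>+\<omega>. F (X a \<omega>) (X b \<omega>) (X d \<omega>) (X j \<omega>) \<partial>M) =
    (\<integral>\<^sup>+\<omega>1. \<integral>\<^sup>+\<omega>2. \<integral>\<^sup>+\<omega>3. \<integral>\<^sup>+\<omega>4. F (X a \<omega>1) (X b \<omega>2) (X d \<omega>3) (X j \<omega>4) \<partial>M \<partial>M \<partial>M \<partial>M)"
proof -
  have Fc [measurable (raw)]: "(\<lambda>x. F (g1 x) (g2 x) (g3 x) (g4 x)) \<in> borel_measurable L"
    if "g1 \<in> L \<rightarrow>\<^sub>M S" "g2 \<in> L \<rightarrow>\<^sub>M S" "g3 \<in> L \<rightarrow>\<^sub>M S" "g4 \<in> L \<rightarrow>\<^sub>M S" for L :: "'z measure" and g1 g2 g3 g4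
    using measurable_compose[OF measurable_Pair[OF that(1) measurable_Pair[OF that(2) measurable_Pair[OF that(3,4)]]] F]
    by simp
  let ?I = "{a, b, d, j}"
  have rv: "X i \<in> measurable M S" if "i \<in> ?I" for i
    using indep that unfolding indep_vars_def by blast
  have [measurable]: "X a \<in> measurable M S" "X b \<in> measurable M S" "X d \<in> measurable M S" "X j \<in> measurable M S"
    using rv by auto
  \<comment> \<open>a default outside the four indices, since a product of measures is indexed by the whole type\<close>
  define N where "N i = (if i \<in> ?I then distr M S (X i) else distr M S (X j))" for i
  have sN [measurable_cong]: "sets (N i) = sets S" for i by (simp add: N_def)
  have spN: "space (N i) = space S" for i by (rule sets_eq_imp_space_eq[OF sN])
  have pN: "prob_space (N i)" for i
    using rv by (auto simp: N_def intro!: prob_space_distr)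
  interpret product_sigma_finite N
    by (rule product_sigma_finite.intro) (rule prob_space_imp_sigma_finite[OF pN])
  have Ni: "sigma_finite_measure (N i)" for i by (rule prob_space_imp_sigma_finite[OF pN])
  have sets_eq: "sets (\<Pi>\<^sub>M i\<in>I. N i) = sets (\<Pi>\<^sub>M i\<in>I. S)" for I
    by (rule sets_PiM_cong) (auto simp: sN)
  have eq: "distr M (\<Pi>\<^sub>M i\<in>?I. S) (\<lambda>x. \<lambda>i\<in>?I. X i x) = (\<Pi>\<^sub>M i\<in>?I. N i)"
  proof -
    have "distr M (\<Pi>\<^sub>M i\<in>?I. S) (\<lambda>x. \<lambda>i\<in>?I. X i x) = (\<Pi>\<^sub>M i\<in>?I. distr M S (X i))"
      by (rule indep_vars_iff_distr_eq_PiM'[THEN iffD1, OF _ _ indep]) (use rv in auto)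
    also have "\<dots> = (\<Pi>\<^sub>M i\<in>?I. N i)"
      by (rule PiM_cong) (auto simp: N_def)
    finally show ?thesis .
  qed
  let ?F = "\<lambda>w. F (w a) (w b) (w d) (w j)"
  have F0: "?F \<in> borel_measurable (\<Pi>\<^sub>M i\<in>?I. N i)" by measurable
  have F1: "(\<lambda>w. F x (w b) (w d) (w j)) \<in> borel_measurable (\<Pi>\<^sub>M i\<in>{b, d, j}. N i)" if [measurable]: "x \<in> space S" for x
    by measurable
  have F2: "(\<lambda>w. F x y (w d) (w j)) \<in> borel_measurable (\<Pi>\<^sub>M i\<in>{d, j}. N i)"
    if [measurable]: "x \<in> space S" "y \<in> space S" for x y
    by measurable
  have N_int: "(\<integral>\<^sup>+w. g w \<partial>N i) = (\<integral>\<^sup>+\<omega>. g (X i \<omega>) \<partial>M)" if "i \<in> ?I" "g \<in> borel_measurable S" for i and g :: "'b \<Rightarrow> ennreal"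
    unfolding N_def using that rv by (simp add: nn_integral_distr)
  have "(\<integral>\<^sup>+\<omega>. F (X a \<omega>) (X b \<omega>) (X d \<omega>) (X j \<omega>) \<partial>M) = (\<integral>\<^sup>+w. ?F w \<partial>distr M (\<Pi>\<^sub>M i\<in>?I. S) (\<lambda>x. \<lambda>i\<in>?I. X i x))"
    using F0 rv by (subst nn_integral_distr) (auto simp: measurable_cong_sets[OF sets_eq refl] intro!: measurable_restrict)
  also have "\<dots> = (\<integral>\<^sup>+w. ?F w \<partial>(\<Pi>\<^sub>M i\<in>insert a {b, d, j}. N i))" unfolding eq ..
  also have "\<dots> = (\<integral>\<^sup>+w1. \<integral>\<^sup>+w. F w1 (w b) (w d) (w j) \<partial>(\<Pi>\<^sub>M i\<in>insert b {d, j}. N i) \<partial>N a)"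
    using dist F0 by (subst product_nn_integral_insert_rev) auto
  also have "\<dots> = (\<integral>\<^sup>+w1. \<integral>\<^sup>+w2. \<integral>\<^sup>+w. F w1 w2 (w d) (w j) \<partial>(\<Pi>\<^sub>M i\<in>{d, j}. N i) \<partial>N b \<partial>N a)"
    using dist F1 by (intro nn_integral_cong, subst product_nn_integral_insert_rev) (auto simp: spN)
  also have "\<dots> = (\<integral>\<^sup>+w1. \<integral>\<^sup>+w2. \<integral>\<^sup>+w3. \<integral>\<^sup>+w4. F w1 w2 w3 w4 \<partial>N j \<partial>N d \<partial>N b \<partial>N a)"
  proof (intro nn_integral_cong)
    fix x y assume "x \<in> space (N a)" "y \<in> space (N b)"
    then have [measurable]: "x \<in> space S" "y \<in> space S" by (auto simp: spN)
    have "(\<integral>\<^sup>+w. F x y (w d) (w j) \<partial>(\<Pi>\<^sub>M i\<in>insert d {j}. N i)) = (\<integral>\<^sup>+z. \<integral>\<^sup>+w. F x y z (w j) \<partial>(\<Pi>\<^sub>M i\<in>{j}. N i) \<partial>N d)"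
      using dist F2 \<open>x \<in> space S\<close> \<open>y \<in> space S\<close> by (subst product_nn_integral_insert_rev) auto
    also have "\<dots> = (\<integral>\<^sup>+w3. \<integral>\<^sup>+w4. F x y w3 w4 \<partial>N j \<partial>N d)"
    proof (intro nn_integral_cong product_nn_integral_singleton)
      fix z assume "z \<in> space (N d)"
      then have [measurable]: "z \<in> space S" by (auto simp: spN)
      show "F x y z \<in> borel_measurable (N j)"
        by (rule Fc[of "\<lambda>_. x" "N j" "\<lambda>_. y" "\<lambda>_. z" "\<lambda>w. w"];
            (rule measurable_const measurable_ident_sets; fact sN \<open>x \<in> space S\<close> \<open>y \<in> space S\<close> \<open>z \<in> space S\<close>)?)
    qed
    finally show "(\<integral>\<^sup>+w. F x y (w d) (w j) \<partial>(\<Pi>\<^sub>M i\<in>{d, j}. N i)) = (\<integral>\<^sup>+w3. \<integral>\<^sup>+w4. F x y w3 w4 \<partial>N j \<partial>N d)" .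
  qed
  also have "\<dots> = (\<integral>\<^sup>+w1. \<integral>\<^sup>+w2. \<integral>\<^sup>+w3. \<integral>\<^sup>+\<omega>4. F w1 w2 w3 (X j \<omega>4) \<partial>M \<partial>N d \<partial>N b \<partial>N a)"
  proof (intro nn_integral_cong N_int)
    fix x y z assume "x \<in> space (N a)" "y \<in> space (N b)" "z \<in> space (N d)"
    then have [measurable]: "x \<in> space S" "y \<in> space S" "z \<in> space S" by (auto simp: spN)
    show "F x y z \<in> borel_measurable S"
      by (rule Fc[of "\<lambda>_. x" S "\<lambda>_. y" "\<lambda>_. z" "\<lambda>w. w"];
          (rule measurable_const measurable_ident_sets; fact refl \<open>x \<in> space S\<close> \<open>y \<in> space S\<close> \<open>z \<in> space S\<close>)?)
  qed simp
  also have "\<dots> = (\<integral>\<^sup>+w1. \<integral>\<^sup>+w2. \<integral>\<^sup>+\<omega>3. \<integral>\<^sup>+\<omega>4. F w1 w2 (X d \<omega>3) (X j \<omega>4) \<partial>M \<partial>M \<partial>N b \<partial>N a)"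
  proof (intro nn_integral_cong N_int)
    fix x y assume "x \<in> space (N a)" "y \<in> space (N b)"
    then have [measurable]: "x \<in> space S" "y \<in> space S" by (auto simp: spN)
    show "(\<lambda>z. \<integral>\<^sup>+\<omega>4. F x y z (X j \<omega>4) \<partial>M) \<in> borel_measurable S" by measurable
  qed simp
  also have "\<dots> = (\<integral>\<^sup>+w1. \<integral>\<^sup>+\<omega>2. \<integral>\<^sup>+\<omega>3. \<integral>\<^sup>+\<omega>4. F w1 (X b \<omega>2) (X d \<omega>3) (X j \<omega>4) \<partial>M \<partial>M \<partial>M \<partial>N a)"
  proof (intro nn_integral_cong N_int)
    fix x assume "x \<in> space (N a)"
    then have [measurable]: "x \<in> space S" by (auto simp: spN)
    show "(\<lambda>y. \<integral>\<^sup>+\<omega>3. \<integral>\<^sup>+\<omega>4. F x y (X d \<omega>3) (X j \<omega>4) \<partial>M \<partial>M) \<in> borel_measurable S" by measurable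
  qed simp
  also have "\<dots> = (\<integral>\<^sup>+\<omega>1. \<integral>\<^sup>+\<omega>2. \<integral>\<^sup>+\<omega>3. \<integral>\<^sup>+\<omega>4. F (X a \<omega>1) (X b \<omega>2) (X d \<omega>3) (X j \<omega>4) \<partial>M \<partial>M \<partial>M \<partial>M)"
    by (intro N_int) measurable
  finally show ?thesis .
qed

section \<open>The law of the cyclic motion\<close>

locale cyclic_motion = prob_space M + tetrahedral_directions c v
  for M :: "'a measure" and c v +
  fixes l :: "nat \<Rightarrow> real" and D :: "nat \<Rightarrow> nat \<Rightarrow> 'a \<Rightarrow> real"
    and f :: "nat \<Rightarrow> nat \<Rightarrow> real \<Rightarrow> ennreal" and G :: "nat \<Rightarrow> nat \<Rightarrow> real \<Rightarrow> real \<Rightarrow> real"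
  assumes gcp: "\<And>i. i \<in> {1..4} \<Longrightarrow> gcp_interarrivals M (l i) (D i)"
    and indep_seq: "indep_vars (\<lambda>_. PiM {1..} (\<lambda>_. borel)) (\<lambda>i \<omega>. \<lambda>k\<in>{1..}. D i k \<omega>) {1..4}"
    and dens: "\<And>i k. i \<in> {1..4} \<Longrightarrow> k \<ge> 1 \<Longrightarrow> distributed M lborel (partial_duration D i k) (f i k)"
    and surv: "\<And>i k. i \<in> {1..4} \<Longrightarrow> k \<ge> 1 \<Longrightarrow>
      is_cond_survival M (D i (k + 1)) (partial_duration D i k) (G i k)"
begin

lemma D_measurable: "i \<in> {1..4} \<Longrightarrow> k \<ge> 1 \<Longrightarrow> D i k \<in> borel_measurable M"
  using gcp unfolding gcp_interarrivals_def by blast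

lemma partial_duration_measurable:
  "i \<in> {1..4} \<Longrightarrow> partial_duration D i k \<in> borel_measurable M"
  by (rule measurable_partial_duration[OF D_measurable])

lemma AE_regular: "AE \<omega> in M. regular_path D \<omega>"
proof -
  have "AE \<omega> in M. D i k \<omega> > 0" if "i \<in> {1..4}" "k \<in> {1..}" for i k
    using gcp_AE_pos[OF gcp[OF that(1)], of k] that(2) by simp
  then have "AE \<omega> in M. \<forall>i\<in>{1..4}. \<forall>k\<in>{1..}. D i k \<omega> > 0"
    by (intro AE_ball_countable[THEN iffD2] ballI) auto
  moreover have "AE \<omega> in M. \<forall>s. \<exists>k\<ge>1. D 1 k \<omega> > s"
    by (rule gcp_AE_unbounded[OF gcp]) simp
  ultimately show ?thesis
    by eventually_elim (rule regular_path.intro, auto)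
qed

text \<open>
  The probability that leg number \<open>k + 1\<close> along \<open>v j\<close> is running when the particle has spent the total
  time \<open>y\<close> along \<open>v j\<close>. Unlike the survival integral it is visibly measurable in \<open>y\<close>.
\<close>

definition waits :: "nat \<Rightarrow> nat \<Rightarrow> real \<Rightarrow> ennreal" where
  "waits j k y = emeasure M {\<omega>\<in>space M. partial_duration D j k \<omega> \<le> y \<and> y < partial_duration D j (k + 1) \<omega>}"

lemma waits_measurable:
  assumes "j \<in> {1..4}" shows "waits j k \<in> borel_measurable borel"
proof -
  note [measurable] = partial_duration_measurable[OF assms]
  have "waits j k = (\<lambda>y. \<integral>\<^sup>+\<omega>. indicator {\<omega>\<in>space M. partial_duration D j k \<omega> \<le> y \<and> y < partial_duration D j (k + 1) \<omega>} \<omega> \<partial>M)"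
    unfolding waits_def by (auto simp: fun_eq_iff)
  also have "\<dots> = (\<lambda>y. \<integral>\<^sup>+\<omega>. indicator {p. snd p \<le> fst p} (y, partial_duration D j k \<omega>) *
      indicator {p. fst p < snd p} (y, partial_duration D j (k + 1) \<omega>) \<partial>M)"
    by (intro ext nn_integral_cong) (auto split: split_indicator)
  also have "\<dots> \<in> borel_measurable borel" by measurable
  finally show ?thesis .
qed

text \<open>
  For \<open>k = 0\<close> the first condition in \<^const>\<open>waits\<close> reads \<open>0 \<le> y\<close>, so it holds for positive \<open>y\<close> and only the survival
  of the first duration remains; for \<open>k \<ge> 1\<close> the conditional distribution is integrated.
\<close>

lemma waits_eq_survival_integral:
  assumes j: "j \<in> {1..4}" and y: "y > 0"
  shows "survival_integral M D f G j k t y = waits j k y"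
proof (cases "k = 0")
  case True
  then show ?thesis using y by (simp add: survival_integral_def waits_def partial_duration_def)
next
  case False
  have pos: "AE \<omega> in M. partial_duration D j k \<omega> \<ge> 0"
    using AE_regular by eventually_elim (rule regular_path.partial_duration_nonneg[OF _ j])
  have "partial_duration D j (k + 1) \<omega> = partial_duration D j k \<omega> + D j (k + 1) \<omega>" for \<omega>
    by (simp add: partial_duration_def)
  then show ?thesis
    using survival_integral_eq[OF dens[OF j] D_measurable[OF j] surv[OF j] pos, of t y] False
    by (simp add: survival_integral_def waits_def)
qed

text \<open>
  Time spent along \<open>v j\<close> up to time \<open>t\<close>, provided that leg number \<open>k + 1\<close> along \<open>v j\<close> is running.
\<close>

definition time_along :: "nat \<Rightarrow> nat \<Rightarrow> real \<Rightarrow> 'a \<Rightarrow> real" where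
  "time_along j k t \<omega> = t - (\<Sum>i\<in>{1..4} - {j}. partial_duration D i (legs j k i) \<omega>)"

text \<open>
  Leg number \<open>k + 1\<close> along \<open>v j\<close> is running at time \<open>t\<close>, expressed by the durations alone so that
  independence applies. On regular paths this agrees with the description by switching times and
  position (lemma \<open>phase_event_iff\<close>).
\<close>

definition phase_event :: "nat \<Rightarrow> nat \<Rightarrow> real \<Rightarrow> (real^3) set \<Rightarrow> 'a set" where
  "phase_event j k t B = {\<omega>\<in>space M.
     partial_duration D j k \<omega> \<le> time_along j k t \<omega> \<and> time_along j k t \<omega> < partial_duration D j (k + 1) \<omega> \<and>
     c *\<^sub>R ((\<Sum>i\<in>{1..4} - {j}. partial_duration D i (legs j k i) \<omega> *\<^sub>R v i) + time_along j k t \<omega> *\<^sub>R v j) \<in> B}"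

lemma phase_event_iff:
  assumes reg: "regular_path D \<omega>" and \<omega>: "\<omega> \<in> space M" and j: "j \<in> {1..4}"
  shows "\<omega> \<in> phase_event j k t B \<longleftrightarrow>
    switching_time D (4 * k + j - 1) \<omega> \<le> t \<and> t < switching_time D (4 * k + j) \<omega> \<and> position c v D t \<omega> \<in> B"
proof -
  interpret regular_path D \<omega> by fact
  let ?m = "4 * k + j - 1"
  define s where "s = (\<Sum>i\<in>{1..4} - {j}. partial_duration D i (legs j k i) \<omega>)"
  have m: "?m mod 4 + 1 = j" "?m div 4 = k" "Suc ?m = 4 * k + j"
  proof -
    obtain r where "j = Suc r" "r < 4" using j by (cases j) auto
    then show "?m mod 4 + 1 = j" "?m div 4 = k" "Suc ?m = 4 * k + j" by simp_all
  qed
  have split: "(\<Sum>i=1..4. g i (partial_duration D i ((?m + 4 - i) div 4) \<omega>)) =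
      (\<Sum>i\<in>{1..4} - {j}. g i (partial_duration D i (legs j k i) \<omega>)) + g j (partial_duration D j k \<omega>)"
    for g :: "nat \<Rightarrow> real \<Rightarrow> 'z::comm_monoid_add"
  proof -
    have "(\<Sum>i=1..4. g i (partial_duration D i ((?m + 4 - i) div 4) \<omega>)) = (\<Sum>i=1..4. g i (partial_duration D i (legs j k i) \<omega>))"
      by (rule sum.cong[OF refl]) (simp only: completed_phases[OF _ j])
    also have "\<dots> = g j (partial_duration D j (legs j k j) \<omega>) + (\<Sum>i\<in>{1..4} - {j}. g i (partial_duration D i (legs j k i) \<omega>))"
      by (rule sum.remove) (use j in auto)
    finally show ?thesis by (simp add: add.commute legs_def)
  qed
  have T: "T ?m = s + partial_duration D j k \<omega>"
    unfolding switching_time_eq s_def using split[of "\<lambda>_ x. x"] by simp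
  have T': "T (4 * k + j) = s + partial_duration D j (k + 1) \<omega>"
    using switching_time_Suc[of D ?m \<omega>] unfolding m T by (simp add: partial_duration_def)
  have pos: "position c v D t \<omega> = c *\<^sub>R ((\<Sum>i\<in>{1..4} - {j}. partial_duration D i (legs j k i) \<omega> *\<^sub>R v i) + (t - s) *\<^sub>R v j)"
    if "T ?m \<le> t" "t < T (4 * k + j)"
    using position_in_phase[of ?m t c v] that unfolding m split[of "\<lambda>i x. x *\<^sub>R v i"] T
    by (simp add: algebra_simps)
  show ?thesis
    using \<omega> pos unfolding phase_event_def T T' mem_Collect_eq time_along_def s_def[symmetric] by auto
qed

lemma indicator_eq_suminf_phase_event:
  assumes reg: "regular_path D \<omega>" and \<omega>: "\<omega> \<in> space M" and j: "j \<in> {1..4}" and t: "t \<ge> 0"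
  shows "indicator {\<omega>\<in>space M. position c v D t \<omega> \<in> B \<and> velocity v D t \<omega> = v j} \<omega> =
    (\<Sum>k. indicator (phase_event j k t B) \<omega> :: ennreal)"
proof -
  interpret regular_path D \<omega> by fact
  let ?S = "{\<omega>\<in>space M. position c v D t \<omega> \<in> B \<and> velocity v D t \<omega> = v j}"
  have in_S: "\<omega> \<in> ?S \<longleftrightarrow> (\<exists>k. \<omega> \<in> phase_event j k t B)"
    using velocity_eq_iff[OF inj j t] phase_event_iff[OF reg \<omega> j] \<omega> by blast
  show ?thesis
  proof (cases "\<omega> \<in> ?S")
    case True
    then obtain k where k: "\<omega> \<in> phase_event j k t B" using in_S by blast
    have uniq: "k' = k" if "\<omega> \<in> phase_event j k' t B" for k'
    proof -
      have *: "Suc (4 * i + j - 1) = 4 * i + j" for i using j by simp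
      have "4 * k' + j - 1 = 4 * k + j - 1"
        using k that unfolding phase_event_iff[OF reg \<omega> j]
        by (intro phase_unique[of _ t]) (simp_all only: *)
      then show ?thesis using j by simp
    qed
    have "indicator (phase_event j k' t B) \<omega> = (if k' = k then 1 else 0 :: ennreal)" for k'
    proof (cases "k' = k")
      case False
      then have "\<omega> \<notin> phase_event j k' t B" using uniq by blast
      with False show ?thesis by simp
    qed (use k in simp)
    moreover have "(\<Sum>k'. if k' = k then 1 else 0 :: ennreal) = 1"
      using sums_unique[OF sums_single[of k "\<lambda>_. 1 :: ennreal"]] by simp
    ultimately show ?thesis using True by simp
  next
    case False
    then have "\<omega> \<notin> phase_event j k t B" for k using in_S by blast
    then show ?thesis using False by simp
  qed
qed

lemma phase_event_measurable:
  assumes j: "j \<in> {1..4}" and B [measurable]: "B \<in> sets borel"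
  shows "phase_event j k t B \<in> sets M"
proof -
  have [measurable]: "partial_duration D j n \<in> borel_measurable M" for n
    by (rule partial_duration_measurable[OF j])
  have [measurable]: "(\<lambda>\<omega>. \<Sum>i\<in>{1..4} - {j}. partial_duration D i (legs j k i) \<omega>) \<in> borel_measurable M"
    by (intro borel_measurable_sum partial_duration_measurable) auto
  have [measurable]: "(\<lambda>\<omega>. \<Sum>i\<in>{1..4} - {j}. partial_duration D i (legs j k i) \<omega> *\<^sub>R v i) \<in> borel_measurable M"
    by (intro borel_measurable_sum borel_measurable_scaleR partial_duration_measurable) auto
  show ?thesis unfolding phase_event_def time_along_def by measurable
qed

lemma emeasure_position_velocity:
  assumes j: "j \<in> {1..4}" and B: "B \<in> sets borel" and t: "t \<ge> 0"
  shows "emeasure M {\<omega>\<in>space M. position c v D t \<omega> \<in> B \<and> velocity v D t \<omega> = v j} =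
    (\<Sum>k. emeasure M (phase_event j k t B))"
proof -
  note [measurable] = measurable_position[OF D_measurable] measurable_velocity[OF D_measurable] B
  let ?S = "{\<omega>\<in>space M. position c v D t \<omega> \<in> B \<and> velocity v D t \<omega> = v j}"
  have "?S \<in> sets M" by measurable
  then have "emeasure M ?S = (\<integral>\<^sup>+\<omega>. indicator ?S \<omega> \<partial>M)" by simp
  also have "\<dots> = (\<integral>\<^sup>+\<omega>. (\<Sum>k. indicator (phase_event j k t B) \<omega>) \<partial>M)"
    using AE_regular indicator_eq_suminf_phase_event[OF _ _ j t]
    by (intro nn_integral_cong_AE) auto
  also have "\<dots> = (\<Sum>k. \<integral>\<^sup>+\<omega>. indicator (phase_event j k t B) \<omega> \<partial>M)"
    using phase_event_measurable[OF j B] by (intro nn_integral_suminf) auto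
  finally show ?thesis using phase_event_measurable[OF j B] by simp
qed

text \<open>
  The event involves three partial sums along the other directions and the pair of partial sums
  along \<open>v j\<close>, taken from four independent sequences. Integrating over the pair first gives
  \<^const>\<open>waits\<close>; the other three are then integrated against their densities.
\<close>

lemma emeasure_phase_event_integral:
  assumes j: "j \<in> {1..4}" and idx: "{1..4} - {j} = {a, b, d}" "distinct [a, b, d]"
    and B [measurable]: "B \<in> sets borel"
    and n: "legs j k a \<ge> 1" "legs j k b \<ge> 1" "legs j k d \<ge> 1"
  shows "emeasure M (phase_event j k t B) =
    (\<integral>\<^sup>+u1. \<integral>\<^sup>+u2. \<integral>\<^sup>+u3. f a (legs j k a) u1 * (f b (legs j k b) u2 * (f d (legs j k d) u3 *
      (indicator B (c *\<^sub>R (u1 *\<^sub>R v a + u2 *\<^sub>R v b + u3 *\<^sub>R v d + (t - (u1 + u2 + u3)) *\<^sub>R v j)) *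
       waits j k (t - (u1 + u2 + u3))))) \<partial>lborel \<partial>lborel \<partial>lborel)"
proof -
  have mem: "a \<in> {1..4} - {j}" "b \<in> {1..4} - {j}" "d \<in> {1..4} - {j}"
    unfolding idx(1) by simp_all
  then have abd: "a \<in> {1..4}" "b \<in> {1..4}" "d \<in> {1..4}" "distinct [a, b, d, j]"
    using idx(2) by simp_all
  have I: "{a, b, d, j} = {1..4}"
    using idx(1) j by blast
  let ?S = "PiM {1..} (\<lambda>_. borel) :: (nat \<Rightarrow> real) measure"
  let ?X = "\<lambda>i \<omega>. \<lambda>k\<in>{1..}. D i k \<omega>"
  let ?s = "\<lambda>n w. \<Sum>k=1..n. w k"
  have s_meas [measurable]: "?s n \<in> borel_measurable ?S" for n
    by (intro borel_measurable_sum measurable_component_singleton) auto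
  have s_X: "?s n (?X i \<omega>) = partial_duration D i n \<omega>" for n i \<omega>
    by (simp add: partial_duration_def)
  let ?\<Phi> = "\<lambda>u1 u2 u3. c *\<^sub>R (u1 *\<^sub>R v a + u2 *\<^sub>R v b + u3 *\<^sub>R v d + (t - (u1 + u2 + u3)) *\<^sub>R v j)"
  define H where "H u1 u2 u3 p q = (indicator B (?\<Phi> u1 u2 u3) *
      (indicator {z. fst z \<le> snd z} (p, t - (u1 + u2 + u3)) * indicator {z. fst z < snd z} (t - (u1 + u2 + u3), q)) :: ennreal)"
    for u1 u2 u3 p q :: real
  have H [measurable]: "(\<lambda>x. H (g1 x) (g2 x) (g3 x) (g4 x) (g5 x)) \<in> borel_measurable L"
    if [measurable]: "g1 \<in> borel_measurable L" "g2 \<in> borel_measurable L" "g3 \<in> borel_measurable L"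
      "g4 \<in> borel_measurable L" "g5 \<in> borel_measurable L" for L :: "'z measure" and g1 g2 g3 g4 g5
    unfolding H_def by measurable
  have "emeasure M (phase_event j k t B) = (\<integral>\<^sup>+\<omega>. indicator (phase_event j k t B) \<omega> \<partial>M)"
    using phase_event_measurable[OF j B] by simp
  also have "\<dots> = (\<integral>\<^sup>+\<omega>. H (?s (legs j k a) (?X a \<omega>)) (?s (legs j k b) (?X b \<omega>)) (?s (legs j k d) (?X d \<omega>))
      (?s k (?X j \<omega>)) (?s (k + 1) (?X j \<omega>)) \<partial>M)"
  proof (rule nn_integral_cong)
    fix \<omega> assume "\<omega> \<in> space M"
    then show "indicator (phase_event j k t B) \<omega> = H (?s (legs j k a) (?X a \<omega>)) (?s (legs j k b) (?X b \<omega>)) (?s (legs j k d) (?X d \<omega>))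
      (?s k (?X j \<omega>)) (?s (k + 1) (?X j \<omega>))"
    proof -
      let ?ua = "partial_duration D a (legs j k a) \<omega>" and ?ub = "partial_duration D b (legs j k b) \<omega>"
        and ?ud = "partial_duration D d (legs j k d) \<omega>"
      have sum3: "(\<Sum>i\<in>{1..4} - {j}. g i) = g a + g b + g d" for g :: "nat \<Rightarrow> 'z::comm_monoid_add"
        unfolding idx(1) using idx(2) by (simp add: add.assoc)
      have gen: "(of_bool (P \<and> Q \<and> R) :: ennreal) = of_bool R * (of_bool P * of_bool Q)"
        for P Q R by (cases P; cases Q; cases R) simp_all
      have iff: "\<omega> \<in> phase_event j k t B \<longleftrightarrow> partial_duration D j k \<omega> \<le> t - (?ua + ?ub + ?ud) \<and>
          t - (?ua + ?ub + ?ud) < partial_duration D j (k + 1) \<omega> \<and> ?\<Phi> ?ua ?ub ?ud \<in> B"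
        unfolding phase_event_def time_along_def sum3 using \<open>\<omega> \<in> space M\<close> by blast
      have "indicator (phase_event j k t B) \<omega> = H ?ua ?ub ?ud (partial_duration D j k \<omega>) (partial_duration D j (k + 1) \<omega>)"
        unfolding H_def indicator_def by (simp only: iff gen mem_Collect_eq fst_conv snd_conv)
      then show ?thesis unfolding s_X .
    qed
  qed
  also have "\<dots> = (\<integral>\<^sup>+\<omega>1. \<integral>\<^sup>+\<omega>2. \<integral>\<^sup>+\<omega>3. \<integral>\<^sup>+\<omega>4. H (?s (legs j k a) (?X a \<omega>1)) (?s (legs j k b) (?X b \<omega>2)) (?s (legs j k d) (?X d \<omega>3))
      (?s k (?X j \<omega>4)) (?s (k + 1) (?X j \<omega>4)) \<partial>M \<partial>M \<partial>M \<partial>M)"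
    using indep_seq abd(4)
    by (intro nn_integral_indep_vars4[where S = ?S and X = ?X and
          F = "\<lambda>w1 w2 w3 w4. H (?s (legs j k a) w1) (?s (legs j k b) w2) (?s (legs j k d) w3) (?s k w4) (?s (k + 1) w4)"])
      (simp_all only: I, measurable)
  also have "\<dots> = (\<integral>\<^sup>+\<omega>1. \<integral>\<^sup>+\<omega>2. \<integral>\<^sup>+\<omega>3. (\<lambda>u1 u2 u3. indicator B (?\<Phi> u1 u2 u3) * waits j k (t - (u1 + u2 + u3)))
      (partial_duration D a (legs j k a) \<omega>1) (partial_duration D b (legs j k b) \<omega>2) (partial_duration D d (legs j k d) \<omega>3) \<partial>M \<partial>M \<partial>M)"
  proof -
    have "(\<integral>\<^sup>+\<omega>4. H u1 u2 u3 (partial_duration D j k \<omega>4) (partial_duration D j (k + 1) \<omega>4) \<partial>M) =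
      indicator B (?\<Phi> u1 u2 u3) * waits j k (t - (u1 + u2 + u3))" for u1 u2 u3
    proof -
      note [measurable] = partial_duration_measurable[OF j]
      let ?y = "t - (u1 + u2 + u3)"
      let ?E = "{\<omega>\<in>space M. partial_duration D j k \<omega> \<le> ?y \<and> ?y < partial_duration D j (k + 1) \<omega>}"
      have "(\<integral>\<^sup>+\<omega>4. H u1 u2 u3 (partial_duration D j k \<omega>4) (partial_duration D j (k + 1) \<omega>4) \<partial>M) =
        (\<integral>\<^sup>+\<omega>. indicator B (?\<Phi> u1 u2 u3) * indicator ?E \<omega> \<partial>M)"
        unfolding H_def by (intro nn_integral_cong) (auto simp: indicator_def)
      also have "\<dots> = indicator B (?\<Phi> u1 u2 u3) * emeasure M ?E"
        by (subst nn_integral_cmult) auto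
      finally show ?thesis by (simp add: waits_def)
    qed
    then show ?thesis unfolding s_X by simp
  qed
  also have "\<dots> = (\<integral>\<^sup>+u1. \<integral>\<^sup>+u2. \<integral>\<^sup>+u3. f a (legs j k a) u1 * (f b (legs j k b) u2 * (f d (legs j k d) u3 *
      (indicator B (?\<Phi> u1 u2 u3) * waits j k (t - (u1 + u2 + u3))))) \<partial>lborel \<partial>lborel \<partial>lborel)"
  proof -
    have [measurable]: "waits j k \<in> borel_measurable borel" by (rule waits_measurable[OF j])
    have f_meas [measurable]: "f a (legs j k a) \<in> borel_measurable borel" "f b (legs j k b) \<in> borel_measurable borel"
      "f d (legs j k d) \<in> borel_measurable borel"
      using distributed_borel_measurable[OF dens] abd n by auto
    define h where "h u1 u2 u3 = indicator B (?\<Phi> u1 u2 u3) * waits j k (t - (u1 + u2 + u3))" for u1 u2 u3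
    have h [measurable (raw)]: "(\<lambda>x. h (g1 x) (g2 x) (g3 x)) \<in> borel_measurable L"
      if [measurable]: "g1 \<in> borel_measurable L" "g2 \<in> borel_measurable L" "g3 \<in> borel_measurable L"
      for L :: "'z measure" and g1 g2 g3
      unfolding h_def by measurable
    let ?fa = "f a (legs j k a)" and ?fb = "f b (legs j k b)" and ?fd = "f d (legs j k d)"
    let ?a = "partial_duration D a (legs j k a)" and ?b = "partial_duration D b (legs j k b)" and ?d = "partial_duration D d (legs j k d)"
    have "(\<integral>\<^sup>+\<omega>1. \<integral>\<^sup>+\<omega>2. \<integral>\<^sup>+\<omega>3. h (?a \<omega>1) (?b \<omega>2) (?d \<omega>3) \<partial>M \<partial>M \<partial>M) =
      (\<integral>\<^sup>+\<omega>1. \<integral>\<^sup>+\<omega>2. \<integral>\<^sup>+u3. ?fd u3 * h (?a \<omega>1) (?b \<omega>2) u3 \<partial>lborel \<partial>M \<partial>M)"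
      using abd n by (intro nn_integral_cong distributed_nn_integral[OF dens, symmetric]) auto
    also have "\<dots> = (\<integral>\<^sup>+\<omega>1. \<integral>\<^sup>+u2. ?fb u2 * (\<integral>\<^sup>+u3. ?fd u3 * h (?a \<omega>1) u2 u3 \<partial>lborel) \<partial>lborel \<partial>M)"
      using abd n by (intro nn_integral_cong distributed_nn_integral[OF dens, symmetric]) auto
    also have "\<dots> = (\<integral>\<^sup>+u1. ?fa u1 * (\<integral>\<^sup>+u2. ?fb u2 * (\<integral>\<^sup>+u3. ?fd u3 * h u1 u2 u3 \<partial>lborel) \<partial>lborel) \<partial>lborel)"
      using abd n by (intro distributed_nn_integral[OF dens, symmetric]) auto
    also have "\<dots> = (\<integral>\<^sup>+u1. \<integral>\<^sup>+u2. \<integral>\<^sup>+u3. ?fa u1 * (?fb u2 * (?fd u3 * h u1 u2 u3)) \<partial>lborel \<partial>lborel \<partial>lborel)"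
      by (simp add: nn_integral_cmult)
    finally show ?thesis unfolding h_def .
  qed
  finally show ?thesis .
qed

lemma duration_density_measurable:
  "i \<in> {1..4} \<Longrightarrow> duration_density f i k \<in> borel_measurable borel"
  using distributed_borel_measurable[OF dens[of i k]] by (cases "k = 0") (auto simp: duration_density_def[abs_def])

lemma prod_duration_density:
  assumes "j \<in> {1..4}"
  shows "(\<Prod>i=1..<j. duration_density f i (k + 1) (\<tau> i)) * (\<Prod>i=j+1..4. duration_density f i k (\<tau> i)) =
    (\<Prod>i\<in>{1..4} - {j}. duration_density f i (legs j k i) (\<tau> i))"
proof -
  have *: "{1..4} - {j} = {1..<j} \<union> {j+1..4}" using assms by auto
  have "(\<Prod>i\<in>{1..4} - {j}. duration_density f i (legs j k i) (\<tau> i)) =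
    (\<Prod>i=1..<j. duration_density f i (legs j k i) (\<tau> i)) * (\<Prod>i=j+1..4. duration_density f i (legs j k i) (\<tau> i))"
    unfolding * by (rule prod.union_disjoint) auto
  also have "(\<Prod>i=1..<j. duration_density f i (legs j k i) (\<tau> i)) = (\<Prod>i=1..<j. duration_density f i (k + 1) (\<tau> i))"
    by (rule prod.cong) (auto simp: legs_def)
  also have "(\<Prod>i=j+1..4. duration_density f i (legs j k i) (\<tau> i)) = (\<Prod>i=j+1..4. duration_density f i k (\<tau> i))"
    by (rule prod.cong) (auto simp: legs_def)
  finally show ?thesis ..
qed

lemma tau_split:
  assumes j: "j \<in> {1..4}" and e: "(\<Sum>i\<in>{1..4} - {j}. e i) + e j = t" and i: "i \<in> {1..4}"
  shows "tau c v (c *\<^sub>R ((\<Sum>i\<in>{1..4} - {j}. e i *\<^sub>R v i) + e j *\<^sub>R v j)) t i = e i"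
proof (rule tau_unique[OF _ _ i])
  have split: "(\<Sum>i=1..4. g i) = (\<Sum>i\<in>{1..4} - {j}. g i) + g j" for g :: "nat \<Rightarrow> 'z::comm_monoid_add"
    using j by (subst sum.remove[of _ j]) (auto simp: add.commute)
  show "c *\<^sub>R (\<Sum>i=1..4. e i *\<^sub>R v i) = c *\<^sub>R ((\<Sum>i\<in>{1..4} - {j}. e i *\<^sub>R v i) + e j *\<^sub>R v j)"
    by (simp only: split)
  show "(\<Sum>i=1..4. e i) = t" by (simp only: split e)
qed

text \<open>
  If a direction other than \<open>j\<close> has not been used, then the corresponding component of \<^const>\<open>tau\<close> vanishes,
  so the position is not in the interior.
\<close>

lemma phase_event_empty:
  assumes j: "j \<in> {1..4}" and i: "i \<in> {1..4} - {j}" "legs j k i = 0"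
    and t: "t > 0" and B: "B \<subseteq> interior (tetrahedron c v t)"
  shows "phase_event j k t B = {}"
proof -
  have False if "\<omega> \<in> phase_event j k t B" for \<omega>
  proof -
    define e where "e i = (if i = j then time_along j k t \<omega> else partial_duration D i (legs j k i) \<omega>)" for i
    have e: "(\<Sum>i\<in>{1..4} - {j}. g i (e i)) = (\<Sum>i\<in>{1..4} - {j}. g i (partial_duration D i (legs j k i) \<omega>))"
      for g :: "nat \<Rightarrow> real \<Rightarrow> 'z::comm_monoid_add"
      by (rule sum.cong) (auto simp: e_def)
    let ?x = "c *\<^sub>R ((\<Sum>i\<in>{1..4} - {j}. e i *\<^sub>R v i) + e j *\<^sub>R v j)"
    have x: "?x = c *\<^sub>R ((\<Sum>i\<in>{1..4} - {j}. partial_duration D i (legs j k i) \<omega> *\<^sub>R v i) + time_along j k t \<omega> *\<^sub>R v j)"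
      unfolding e[of "\<lambda>i y. y *\<^sub>R v i"] by (simp add: e_def)
    have "?x \<in> B" unfolding x using that unfolding phase_event_def by blast
    then have "tau c v ?x t i > 0" using B i t by (intro tau_pos) auto
    moreover have "tau c v ?x t i = e i"
    proof (rule tau_split[OF j])
      show "(\<Sum>i\<in>{1..4} - {j}. e i) + e j = t"
        unfolding e[of "\<lambda>i y. y"] by (simp add: e_def time_along_def)
    qed (use i in simp)
    moreover have "e i = 0" using i by (simp add: e_def partial_duration_def)
    ultimately show False by simp
  qed
  then show ?thesis by blast
qed

text \<open>
  The solution \<^const>\<open>tau\<close> inverts the affine map from the three partial sums to the position, so
  the iterated integral is that of a function of the position alone.
\<close>

lemma emeasure_phase_event:
  assumes j: "j \<in> {1..4}" and t: "t > 0"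
    and B [measurable]: "B \<in> sets borel" and B_int: "B \<subseteq> interior (tetrahedron c v t)"
  shows "emeasure M (phase_event j k t B) = (\<integral>\<^sup>+x\<in>B. ennreal (1 / \<bar>det (motion_matrix c v)\<bar>) *
    ((\<Prod>i\<in>{1..4} - {j}. duration_density f i (legs j k i) (tau c v x t i)) *
      survival_integral M D f G j k t (tau c v x t j)) \<partial>lborel)"
proof (cases "\<exists>i\<in>{1..4} - {j}. legs j k i = 0")
  case True
  then obtain i where i: "i \<in> {1..4} - {j}" "legs j k i = 0" by blast
  have zero: "(\<Prod>i\<in>{1..4} - {j}. duration_density f i (legs j k i) (tau c v x t i)) = 0" for x
    using i by (intro prod_zero bexI[of _ i]) (simp_all add: duration_density_def)
  show ?thesis unfolding zero phase_event_empty[OF j i t B_int] by simp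
next
  case False
  obtain a b d :: nat where abd: "(j, a, b, d) \<in> {(1,2,3,4), (2,1,3,4), (3,1,2,4), (4,1,2,3)}"
  proof -
    have "j = 1 \<or> j = 2 \<or> j = 3 \<or> j = 4" using j by auto
    then show ?thesis using that by blast
  qed
  have idx: "{1..4} - {j} = {a, b, d}" "distinct [a, b, d]" "j \<notin> {a, b, d}" "{a, b, d} \<subseteq> {1..4}"
    using abd by (auto simp: numeral_eq_Suc)
  have sum3: "(\<Sum>i\<in>{1..4} - {j}. g i) = g a + g b + g d" for g :: "nat \<Rightarrow> 'z::comm_monoid_add"
    unfolding idx(1) using idx(2) by (simp add: add.assoc)
  have prod3: "(\<Prod>i\<in>{1..4} - {j}. g i) = g a * (g b * g d)" for g :: "nat \<Rightarrow> ennreal"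
    unfolding idx(1) using idx(2) by simp
  have n: "legs j k a \<ge> 1" "legs j k b \<ge> 1" "legs j k d \<ge> 1"
    using False unfolding idx(1) by (auto simp: Suc_le_eq)
  let ?A = "\<chi> r. vector [c * (v a - v j) $ r, c * (v b - v j) $ r, c * (v d - v j) $ r] :: real^3^3"
  let ?p = "(c * t) *\<^sub>R v j"
  let ?\<Phi> = "\<lambda>u1 u2 u3. c *\<^sub>R (u1 *\<^sub>R v a + u2 *\<^sub>R v b + u3 *\<^sub>R v d + (t - (u1 + u2 + u3)) *\<^sub>R v j)"
  have detA: "\<bar>det ?A\<bar> = \<bar>det (motion_matrix c v)\<bar>" by (rule abs_det_motion_matrix[OF abd, symmetric])
  have det0: "det ?A \<noteq> 0"
    using detA motion_matrix_invertible invertible_det_nz by fastforce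
  have \<Phi>: "?\<Phi> u1 u2 u3 = ?p + ?A *v vector [u1, u2, u3]" for u1 u2 u3
    by (simp add: vec_eq_iff forall_3 matrix_vector_mult_def sum_3 algebra_simps)
  define fa fb fd where "fa = f a (legs j k a)" and "fb = f b (legs j k b)" and "fd = f d (legs j k d)"
  have [measurable]: "fa \<in> borel_measurable borel" "fb \<in> borel_measurable borel" "fd \<in> borel_measurable borel"
    using distributed_borel_measurable[OF dens] idx(4) n by (auto simp: fa_def fb_def fd_def)
  note [measurable] = borel_measurable_matrix_vector_mult[of ?A] borel_measurable_tau waits_measurable[OF j]
  define h where "h x = fa (tau c v x t a) * (fb (tau c v x t b) * (fd (tau c v x t d) * (indicator B x * waits j k (tau c v x t j))))" for x
  have h [measurable]: "h \<in> borel_measurable borel" unfolding h_def by measurable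
  have tau\<Phi>: "tau c v (?\<Phi> u1 u2 u3) t a = u1" "tau c v (?\<Phi> u1 u2 u3) t b = u2" "tau c v (?\<Phi> u1 u2 u3) t d = u3"
    "tau c v (?\<Phi> u1 u2 u3) t j = t - (u1 + u2 + u3)" for u1 u2 u3
  proof -
    define e where "e i = (if i = a then u1 else if i = b then u2 else if i = d then u3 else t - (u1 + u2 + u3))" for i
    have e: "e a = u1" "e b = u2" "e d = u3" "e j = t - (u1 + u2 + u3)" using idx(2,3) by (auto simp: e_def)
    have s: "(\<Sum>i\<in>{1..4} - {j}. e i) + e j = t" unfolding sum3 e by simp
    have tau_e: "tau c v (?\<Phi> u1 u2 u3) t i = e i" if "i \<in> {1..4}" for i
      using tau_split[OF j s that] unfolding sum3 e .
    have "a \<in> {1..4}" "b \<in> {1..4}" "d \<in> {1..4}" using idx(4) by blast+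
    note this[THEN tau_e, unfolded e] j[THEN tau_e, unfolded e]
    then show "tau c v (?\<Phi> u1 u2 u3) t a = u1" "tau c v (?\<Phi> u1 u2 u3) t b = u2" "tau c v (?\<Phi> u1 u2 u3) t d = u3"
      "tau c v (?\<Phi> u1 u2 u3) t j = t - (u1 + u2 + u3)" by this+
  qed
  have "emeasure M (phase_event j k t B) =
    (\<integral>\<^sup>+u1. \<integral>\<^sup>+u2. \<integral>\<^sup>+u3. h (?\<Phi> u1 u2 u3) \<partial>lborel \<partial>lborel \<partial>lborel)"
    unfolding emeasure_phase_event_integral[OF j idx(1,2) B n] h_def tau\<Phi> fa_def fb_def fd_def ..
  also have "\<dots> = (\<integral>\<^sup>+u. h (?p + ?A *v u) \<partial>lborel)"
    unfolding \<Phi> by (rule nn_integral_lborel_vec3) measurable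
  also have "\<dots> = ennreal (1 / \<bar>det (motion_matrix c v)\<bar>) * integral\<^sup>N lborel h"
    unfolding nn_integral_lborel_affine[OF det0 h] detA ..
  also have "\<dots> = (\<integral>\<^sup>+x. ennreal (1 / \<bar>det (motion_matrix c v)\<bar>) * h x \<partial>lborel)"
    by (rule nn_integral_cmult[symmetric]) measurable
  also have "\<dots> = (\<integral>\<^sup>+x\<in>B. ennreal (1 / \<bar>det (motion_matrix c v)\<bar>) *
    ((\<Prod>i\<in>{1..4} - {j}. duration_density f i (legs j k i) (tau c v x t i)) *
      survival_integral M D f G j k t (tau c v x t j)) \<partial>lborel)"
  proof (rule nn_integral_cong)
    fix x
    show "ennreal (1 / \<bar>det (motion_matrix c v)\<bar>) * h x = ennreal (1 / \<bar>det (motion_matrix c v)\<bar>) *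
      ((\<Prod>i\<in>{1..4} - {j}. duration_density f i (legs j k i) (tau c v x t i)) *
        survival_integral M D f G j k t (tau c v x t j)) * indicator B x"
    proof (cases "x \<in> B")
      case True
      then have "tau c v x t j > 0" using B_int j t by (intro tau_pos) auto
      note * = waits_eq_survival_integral[OF j this]
      have dd: "duration_density f i (legs j k i) y = f i (legs j k i) y" if "legs j k i \<ge> 1" for i y
        using that by (simp add: duration_density_def)
      show ?thesis
        unfolding h_def prod3 fa_def fb_def fd_def * dd[OF n(1)] dd[OF n(2)] dd[OF n(3)]
        using True by (simp add: mult.assoc)
    qed (simp add: h_def)
  qed
  finally show ?thesis .
qed

definition motion_density :: "nat \<Rightarrow> real \<Rightarrow> real^3 \<Rightarrow> ennreal" where
  "motion_density j t x = ennreal (1 / \<bar>det (motion_matrix c v)\<bar>) *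
     (\<Sum>k. (\<Prod>i=1..<j. duration_density f i (k + 1) (tau c v x t i)) *
           (\<Prod>i=j+1..4. duration_density f i k (tau c v x t i)) *
           survival_integral M D f G j k t (tau c v x t j))"

lemma motion_density_measurable:
  assumes j: "j \<in> {1..4}" and t: "t > 0"
  shows "motion_density j t \<in> borel_measurable (restrict_space borel (interior (tetrahedron c v t)))"
proof -
  note [measurable] = borel_measurable_tau waits_measurable[OF j]
  have dd: "(\<lambda>x. duration_density f i k (tau c v x t i)) \<in> borel_measurable borel" if "i \<in> {1..4}" for i k
    by (rule measurable_compose[OF borel_measurable_tau duration_density_measurable[OF that]])
  have prods [measurable]:
    "(\<lambda>x. \<Prod>i=1..<j. duration_density f i (k + 1) (tau c v x t i)) \<in> borel_measurable borel"
    "(\<lambda>x. \<Prod>i=j+1..4. duration_density f i k (tau c v x t i)) \<in> borel_measurable borel" for k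
    using j by (auto intro!: borel_measurable_prod_ennreal dd)
  have "(\<lambda>x. ennreal (1 / \<bar>det (motion_matrix c v)\<bar>) *
     (\<Sum>k. (\<Prod>i=1..<j. duration_density f i (k + 1) (tau c v x t i)) *
           (\<Prod>i=j+1..4. duration_density f i k (tau c v x t i)) * waits j k (tau c v x t j)))
    \<in> borel_measurable (restrict_space borel (interior (tetrahedron c v t)))"
    by (intro measurable_restrict_space1) measurable
  also have "?this \<longleftrightarrow> motion_density j t \<in> borel_measurable (restrict_space borel (interior (tetrahedron c v t)))"
  proof (rule measurable_cong)
    fix x assume "x \<in> space (restrict_space borel (interior (tetrahedron c v t)))"
    then have "tau c v x t j > 0"
      using t j by (intro tau_pos) (simp_all add: space_restrict_space)
    then show "ennreal (1 / \<bar>det (motion_matrix c v)\<bar>) *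
     (\<Sum>k. (\<Prod>i=1..<j. duration_density f i (k + 1) (tau c v x t i)) *
           (\<Prod>i=j+1..4. duration_density f i k (tau c v x t i)) * waits j k (tau c v x t j)) = motion_density j t x"
      unfolding motion_density_def by (simp only: waits_eq_survival_integral[OF j])
  qed
  finally show ?thesis .
qed

text \<open>
  On the interior the survival integrals may be replaced by \<^const>\<open>waits\<close>, whose measurability allows the
  sum over the cycles to be interchanged with the integral.
\<close>

lemma emeasure_motion:
  assumes j: "j \<in> {1..4}" and t: "t > 0"
    and B [measurable]: "B \<in> sets borel" and B_int: "B \<subseteq> interior (tetrahedron c v t)"
  shows "emeasure M {\<omega>\<in>space M. position c v D t \<omega> \<in> B \<and> velocity v D t \<omega> = v j} = (\<integral>\<^sup>+x\<in>B. motion_density j t x \<partial>lborel)"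
proof -
  let ?C = "ennreal (1 / \<bar>det (motion_matrix c v)\<bar>)"
  let ?p = "\<lambda>k x. (\<Prod>i\<in>{1..4} - {j}. duration_density f i (legs j k i) (tau c v x t i))"
  let ?s = "\<lambda>k x. survival_integral M D f G j k t (tau c v x t j)"
  note [measurable] = waits_measurable[OF j] borel_measurable_tau
  have dd: "(\<lambda>x. duration_density f i k (tau c v x t i)) \<in> borel_measurable borel" if "i \<in> {1..4}" for i k
    by (rule measurable_compose[OF borel_measurable_tau duration_density_measurable[OF that]])
  have [measurable]: "?p k \<in> borel_measurable borel" for k
    by (intro borel_measurable_prod_ennreal dd) auto
  have eq: "?C * (?p k x * ?s k x) * indicator B x = ?C * (?p k x * waits j k (tau c v x t j)) * indicator B x" for k x
  proof (cases "x \<in> B")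
    case True
    then have "tau c v x t j > 0" using B_int j t by (intro tau_pos) auto
    then show ?thesis by (simp only: waits_eq_survival_integral[OF j])
  qed simp
  have "emeasure M {\<omega>\<in>space M. position c v D t \<omega> \<in> B \<and> velocity v D t \<omega> = v j} =
    (\<Sum>k. \<integral>\<^sup>+x. ?C * (?p k x * waits j k (tau c v x t j)) * indicator B x \<partial>lborel)"
    unfolding emeasure_position_velocity[OF j B less_imp_le[OF t]] emeasure_phase_event[OF j t B B_int] eq ..
  also have "\<dots> = (\<integral>\<^sup>+x. (\<Sum>k. ?C * (?p k x * waits j k (tau c v x t j)) * indicator B x) \<partial>lborel)"
    by (rule nn_integral_suminf[symmetric]) measurable
  also have "\<dots> = (\<integral>\<^sup>+x\<in>B. motion_density j t x \<partial>lborel)"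
    unfolding motion_density_def prod_duration_density[OF j] eq[symmetric]
    by (simp only: ennreal_suminf_multc ennreal_suminf_cmult)
  finally show ?thesis .
qed

text \<open>
  The motion almost surely starts at the origin with direction \<open>v 1\<close>, so the conditioning is void.
\<close>

lemma cond_prob_motion:
  assumes j: "j \<in> {1..4}" and t: "t > 0" and B [measurable]: "B \<in> sets borel"
  shows "ennreal (cond_prob M (\<lambda>\<omega>. position c v D t \<omega> \<in> B \<and> velocity v D t \<omega> = v j)
      (\<lambda>\<omega>. position c v D 0 \<omega> = 0 \<and> velocity v D 0 \<omega> = v 1)) =
    emeasure M {\<omega>\<in>space M. position c v D t \<omega> \<in> B \<and> velocity v D t \<omega> = v j}"
proof -
  note [measurable] = measurable_position[of D M c v, OF D_measurable] measurable_velocity[of D M v, OF D_measurable]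
  have start: "AE \<omega> in M. position c v D 0 \<omega> = 0 \<and> velocity v D 0 \<omega> = v 1"
    using AE_regular
  proof eventually_elim
    case (elim \<omega>)
    interpret regular_path D \<omega> by fact
    have T: "T 0 \<le> 0" "0 < T (Suc 0)" using T_Suc_gt[of 0] by (simp_all add: switching_time_0)
    have "position c v D 0 \<omega> = 0"
      using position_in_phase[OF T, of c v] by (simp add: switching_time_0 partial_duration_def)
    moreover have "velocity v D 0 \<omega> = v 1" using velocity_in_phase[OF T, of v] by simp
    ultimately show ?case ..
  qed
  have "prob {\<omega>\<in>space M. position c v D 0 \<omega> = 0 \<and> velocity v D 0 \<omega> = v 1} = 1"
    by (subst prob_Collect_eq_1) (use start in measurable)
  moreover have "prob {\<omega>\<in>space M. (position c v D t \<omega> \<in> B \<and> velocity v D t \<omega> = v j) \<and>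
      position c v D 0 \<omega> = 0 \<and> velocity v D 0 \<omega> = v 1} =
    prob {\<omega>\<in>space M. position c v D t \<omega> \<in> B \<and> velocity v D t \<omega> = v j}"
  proof (rule measure_eq_AE)
    show "AE \<omega> in M. \<omega> \<in> {\<omega>\<in>space M. (position c v D t \<omega> \<in> B \<and> velocity v D t \<omega> = v j) \<and>
        position c v D 0 \<omega> = 0 \<and> velocity v D 0 \<omega> = v 1} \<longleftrightarrow>
      \<omega> \<in> {\<omega>\<in>space M. position c v D t \<omega> \<in> B \<and> velocity v D t \<omega> = v j}"
      using start by eventually_elim blast
  qed measurable
  ultimately show ?thesis
    by (simp add: cond_prob_def emeasure_eq_measure)
qed

lemma is_motion_density_motion_density:
  assumes j: "j \<in> {1..4}" and t: "t > 0"
  shows "is_motion_density M c v D j t (motion_density j t)"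
  unfolding is_motion_density_def
  using motion_density_measurable[OF j t] emeasure_motion[OF j t] cond_prob_motion[OF j t] by simp

end

lemma is_motion_density_unique:
  assumes p: "is_motion_density M c v D j t p" and q: "is_motion_density M c v D j t q"
  shows "AE x in lborel. x \<in> interior (tetrahedron c v t) \<longrightarrow> p x = q x"
proof -
  let ?I = "interior (tetrahedron c v t)"
  have I: "?I \<in> sets borel" by simp
  have meas: "(\<lambda>x. r x * indicator ?I x) \<in> borel_measurable lborel"
    if "is_motion_density M c v D j t r" for r
    using that borel_measurable_restrict_space_iff_ennreal[of ?I borel r] I
    unfolding is_motion_density_def by (simp add: mult.commute)
  have "density lborel (\<lambda>x. p x * indicator ?I x) = density lborel (\<lambda>x. q x * indicator ?I x)"
  proof (rule measure_eqI)
    fix A assume "A \<in> sets (density lborel (\<lambda>x. p x * indicator ?I x))"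
    then have A: "A \<in> sets lborel" by simp
    have "emeasure (density lborel (\<lambda>x. r x * indicator ?I x)) A =
        ennreal (cond_prob M (\<lambda>\<omega>. position c v D t \<omega> \<in> A \<inter> ?I \<and> velocity v D t \<omega> = v j)
          (\<lambda>\<omega>. position c v D 0 \<omega> = 0 \<and> velocity v D 0 \<omega> = v 1))"
      if r: "is_motion_density M c v D j t r" for r
    proof -
      have AI: "A \<inter> ?I \<in> sets borel" "A \<inter> ?I \<subseteq> ?I" using A by auto
      have "emeasure (density lborel (\<lambda>x. r x * indicator ?I x)) A = (\<integral>\<^sup>+x\<in>A \<inter> ?I. r x \<partial>lborel)"
        using A by (subst emeasure_density[OF meas[OF r]])
          (auto intro!: nn_integral_cong simp: indicator_def)
      also have "\<dots> = ennreal (cond_prob M (\<lambda>\<omega>. position c v D t \<omega> \<in> A \<inter> ?I \<and> velocity v D t \<omega> = v j)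
          (\<lambda>\<omega>. position c v D 0 \<omega> = 0 \<and> velocity v D 0 \<omega> = v 1))"
        using r[unfolded is_motion_density_def, THEN conjunct2, THEN bspec, OF AI(1), THEN mp, OF AI(2)] by (rule sym)
      finally show ?thesis .
    qed
    from this[OF p] this[OF q]
    show "emeasure (density lborel (\<lambda>x. p x * indicator ?I x)) A = emeasure (density lborel (\<lambda>x. q x * indicator ?I x)) A"
      by simp
  qed simp
  then have "AE x in lborel. p x * indicator ?I x = q x * indicator ?I x"
    by (intro sigma_finite_measure.density_unique[OF lborel.sigma_finite_measure_axioms] meas p q)
  then show ?thesis by eventually_elim auto
qed

theorem theorem3:
  fixes M :: "'a measure"
    and c :: real
    and \<theta> \<phi> l :: "nat \<Rightarrow> real"
    and v :: "nat \<Rightarrow> real^3"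
    and D :: "nat \<Rightarrow> nat \<Rightarrow> 'a \<Rightarrow> real"
    and f :: "nat \<Rightarrow> nat \<Rightarrow> real \<Rightarrow> ennreal"
    and G :: "nat \<Rightarrow> nat \<Rightarrow> real \<Rightarrow> real \<Rightarrow> real"
  assumes "prob_space M"
    and "c > 0"
    and "\<And>j. j \<in> {1..4} \<Longrightarrow> \<theta> j \<in> {0..2 * pi} \<and> \<phi> j \<in> {0..pi}"
    and "\<And>j. j \<in> {1..4} \<Longrightarrow> v j = direction (\<theta> j) (\<phi> j)"
    and "inj_on v {1..4}" and "\<not> affine_dependent (v ` {1..4})"
    and "\<And>j. j \<in> {1..4} \<Longrightarrow> l j > 0"
    and "\<And>j. j \<in> {1..4} \<Longrightarrow> gcp_interarrivals M (l j) (D j)"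
    and "prob_space.indep_vars M (\<lambda>_. PiM {1..} (\<lambda>_. borel))
           (\<lambda>j \<omega>. \<lambda>k\<in>{1..}. D j k \<omega>) {1..4}"
    and "\<And>j k. j \<in> {1..4} \<Longrightarrow> k \<ge> 1 \<Longrightarrow>
           distributed M lborel (partial_duration D j k) (f j k)"
    and "\<And>j k. j \<in> {1..4} \<Longrightarrow> k \<ge> 1 \<Longrightarrow>
           is_cond_survival M (D j (k + 1)) (partial_duration D j k) (G j k)"
  shows "\<forall>t>0. \<forall>j\<in>{1..4}.
    let q = (\<lambda>x. ennreal (1 / \<bar>det (motion_matrix c v)\<bar>) *
          (\<Sum>k. (\<Prod>i=1..<j. duration_density f i (k + 1) (tau c v x t i)) *
                (\<Prod>i=j+1..4. duration_density f i k (tau c v x t i)) *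
                survival_integral M D f G j k t (tau c v x t j)))
    in is_motion_density M c v D j t q \<and>
       (\<forall>p. is_motion_density M c v D j t p \<longrightarrow>
          (AE x in lborel. x \<in> interior (tetrahedron c v t) \<longrightarrow> p x = q x))"
proof -
  interpret prob_space M by fact
  interpret cyclic_motion M c v l D f G
    by unfold_locales (use assms in auto)
  show ?thesis
    unfolding Let_def motion_density_def[symmetric, abs_def]
    using is_motion_density_motion_density is_motion_density_unique by blast
qed

end
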